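(* Let $\omega$ be a nontrivial cube root of unity, let $\omega_1\in\mathbb{C}\setminus\{0\}$, let $\Lambda=\mathbb{Z}\omega_1+\mathbb{Z}\,\omega\omega_1$ be a hexagonal lattice, let $\wp(z)=\wp(z;\Lambda)$, and let $G$ be the wallpaper group p6 realised as the group generated by the translations $z\mapsto z+\lambda$ ($\lambda\in\Lambda$) and the two commuting rotations $z\mapsto -z$ and $z\mapsto\omega z$. Then the $G$-invariant meromorphic functions $f:\mathbb{C}\to\mathbb{CP}^1$ are precisely the functions of the form $f(z)=U(\wp(z)^3)$ with $U$ a rational function with complex coefficients; equivalently, they are precisely the functions of the form $f(z)=V(\wp'(z)^2)$ with $V$ a rational function with complex coefficients.
   Context: $f$ is $G$-invariant if $f(g.z)=f(z)$ for all $g\in G$ and $z\in\mathbb{C}$. The Weierstrass function of a lattice $\Lambda$ is $\wp(z;\Lambda)=\frac1{z^2}+\sum_{\lambda\in\Lambda\setminus\{0\}}\left(\frac1{(z-\lambda)^2}-\frac1{\lambda^2}\right)$. *)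

theory Defs
  imports
    "HOL-Complex_Analysis.Complex_Analysis"
    "HOL-Computational_Algebra.Computational_Algebra"
    "HOL-Algebra.Bij"
    "HOL-Algebra.Generated_Groups"
begin

datatype riemann_sphere = Finite complex | Infty

text \<open>
  A function that is meromorphic in the sense of the library takes junk values at its poles and
  removable singularities. \<open>to_sphere g\<close> is the map into the Riemann sphere it stands for: it is
  determined by the limits of \<open>g\<close> alone and does not depend on those junk values.
\<close>

definition to_sphere :: "(complex \<Rightarrow> complex) \<Rightarrow> complex \<Rightarrow> riemann_sphere" where
  "to_sphere g z = (if is_pole g z then Infty else Finite (remove_sings g z))"

text \<open>The constant map \<open>\<infinity>\<close> is not a meromorphic function.\<close>

definition meromorphic_map :: "(complex \<Rightarrow> riemann_sphere) \<Rightarrow> bool" where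
  "meromorphic_map f \<longleftrightarrow> (\<exists>g. g meromorphic_on UNIV \<and> f = to_sphere g)"

text \<open>
  \<open>rational_eval p q\<close> is \<open>p / q\<close> as a self-map of the sphere. It is only meaningful for coprime
  \<open>p\<close> and \<open>q\<close> with \<open>q \<noteq> 0\<close>; its value at \<open>\<infinity>\<close> is the limit of \<open>p / q\<close> there.
\<close>

fun rational_eval :: "complex poly \<Rightarrow> complex poly \<Rightarrow> riemann_sphere \<Rightarrow> riemann_sphere" where
  "rational_eval p q (Finite w) =
     (if poly q w = 0 then Infty else Finite (poly p w / poly q w))"
| "rational_eval p q Infty =
     (if degree p > degree q then Infty else Finite (coeff p (degree q) / lead_coeff q))"

definition rational_map :: "(riemann_sphere \<Rightarrow> riemann_sphere) \<Rightarrow> bool" where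
  "rational_map U \<longleftrightarrow> (\<exists>p q. q \<noteq> 0 \<and> coprime p q \<and> U = rational_eval p q)"

definition lattice_of :: "complex \<Rightarrow> complex \<Rightarrow> complex set" where
  "lattice_of w1 w2 = {of_int m * w1 + of_int n * w2 | m n :: int. True}"

text \<open>The value at a lattice point is junk, since \<open>1 / 0 = 0\<close>.\<close>

definition weierstrass_p :: "complex set \<Rightarrow> complex \<Rightarrow> complex" where
  "weierstrass_p \<Lambda> z = 1 / z ^ 2 + (\<Sum>\<^sub>\<infinity>l\<in>\<Lambda> - {0}. (1 / (z - l) ^ 2 - 1 / l ^ 2))"

definition p6_group :: "complex \<Rightarrow> complex set \<Rightarrow> (complex \<Rightarrow> complex) set" where
  "p6_group \<omega> \<Lambda> = generate (BijGroup UNIV)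
     ({(\<lambda>z. z + l) | l. l \<in> \<Lambda>} \<union> {\<lambda>z. - z, \<lambda>z. \<omega> * z})"

definition invariant_under ::
    "(complex \<Rightarrow> complex) set \<Rightarrow> (complex \<Rightarrow> riemann_sphere) \<Rightarrow> bool" where
  "invariant_under G f \<longleftrightarrow> (\<forall>g\<in>G. \<forall>z. f (g z) = f z)"

end

theory Submission
  imports Defs "HOL-Computational_Algebra.Field_as_Ring"
begin

text \<open>
  Both \<open>\<wp>\<^sup>3\<close> and \<open>\<wp>'\<^sup>2\<close> are \<open>G\<close>-invariant with poles of order exactly 6 at the lattice points
  and nowhere else, and only this is used of such a function \<open>Q\<close>; the differential equation of
  \<open>\<wp>\<close> plays no role. Let \<open>f\<close> be \<open>G\<close>-invariant. If \<open>f\<close> has poles only in \<open>\<Lambda>\<close>, then invariance under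
  \<open>-1\<close> and \<open>\<omega>\<close> kills the leading Laurent coefficient at 0 unless the order of the pole is a
  multiple \<open>6k\<close> of 6, and in that case subtracting a multiple of \<open>Q\<^sup>k\<close> lowers the order; by Liouville's
  theorem this descent ends in a constant, so \<open>f\<close> is a polynomial in \<open>Q\<close>. In general \<open>f\<close> has
  finitely many poles \<open>a\<close> outside \<open>\<Lambda>\<close> up to translation, and multiplying by suitable powers of
  \<open>Q - Q a\<close> reduces to the previous case.
\<close>

subsection \<open>Hexagonal lattices and the Weierstrass function\<close>

text \<open>Serves with \<open>s = 3/2\<close> as one factor of a product majorant for double
  series. Each half of the integers reduces to the p-series; their overlap at 0 does no harm to
  summability.\<close>

lemma summable_on_int_powr:
  assumes "s > 1"
  shows "(\<lambda>m::int. (1 + real_of_int \<bar>m\<bar>) powr -s) summable_on UNIV"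
proof -
  have "summable (\<lambda>n::nat. real n powr -s)"
    using assms by (simp add: summable_real_powr_iff)
  hence "summable (\<lambda>n. real (Suc n) powr -s)"
    by (subst summable_Suc_iff)
  hence nat: "(\<lambda>n::nat. (1 + real n) powr -s) summable_on UNIV"
    by (intro norm_summable_imp_summable_on) (simp add: add_ac)
  have "(\<lambda>m::int. (1 + real_of_int \<bar>m\<bar>) powr -s) summable_on range int"
    by (subst summable_on_reindex) (auto simp: o_def inj_on_def nat)
  moreover have "(\<lambda>m::int. (1 + real_of_int \<bar>m\<bar>) powr -s) summable_on range (\<lambda>n. - int n)"
    by (subst summable_on_reindex) (auto simp: o_def inj_on_def nat)
  ultimately have "(\<lambda>m::int. (1 + real_of_int \<bar>m\<bar>) powr -s)
                     summable_on (range int \<union> range (\<lambda>n. - int n))"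
    by (rule summable_on_union)
  also have "range int \<union> range (\<lambda>n. - int n) = UNIV"
    by (auto, metis int_cases2 rangeI)
  finally show ?thesis .
qed

lemma DERIV_inverse_square:
  fixes z l :: "'a :: real_normed_field"
  assumes "z \<noteq> l"
  shows "((\<lambda>z. 1 / (z - l) ^ 2) has_field_derivative (- 2 / (z - l) ^ 3)) (at z)"
proof -
  define w where "w = z - l"
  have w: "w \<noteq> 0" using assms by (simp add: w_def)
  have "((\<lambda>z. 1 / z ^ 2) has_field_derivative (- 2 / w ^ 3)) (at w)"
    using w by (auto intro!: derivative_eq_intros simp: power2_eq_square power3_eq_cube field_simps)
  hence "((\<lambda>z. 1 / (z - l) ^ 2) has_field_derivative (- 2 / w ^ 3 * 1)) (at z)"
    unfolding w_def by (rule DERIV_chain2) (auto intro!: derivative_eq_intros)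
  thus ?thesis by (simp add: w_def)
qed

section \<open>Arithmetic and discreteness of the hexagonal lattice\<close>

locale hexagonal_lattice =
  fixes \<omega> \<omega>1 :: complex
  assumes omega_cubed: "\<omega> ^ 3 = 1" and omega_neq_1: "\<omega> \<noteq> 1" and omega1_nz: "\<omega>1 \<noteq> 0"
begin

abbreviation L :: "complex set" where "L \<equiv> lattice_of \<omega>1 (\<omega> * \<omega>1)"

abbreviation wp :: "complex \<Rightarrow> complex" where "wp \<equiv> weierstrass_p L"

lemma omega_sum: "\<omega>\<^sup>2 + \<omega> + 1 = 0"
proof -
  have "(\<omega> - 1) * (\<omega>\<^sup>2 + \<omega> + 1) = 0"
    using omega_cubed by (simp add: algebra_simps power2_eq_square power3_eq_cube)
  thus ?thesis using omega_neq_1 by simp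
qed

lemma omega_nz: "\<omega> \<noteq> 0"
  using omega_cubed by auto

lemma omega_squared: "\<omega>\<^sup>2 = - 1 - \<omega>"
  using omega_sum by (simp add: eq_neg_iff_add_eq_0 algebra_simps)

text \<open>Real and imaginary parts of \<open>omega_sum\<close>. Both nontrivial cube roots are
  covered, so the sign of \<open>Im \<omega>\<close> stays open and only its square is
  determined.\<close>

lemma Re_omega: "Re \<omega> = - 1 / 2" and Im_omega_squared: "(Im \<omega>)\<^sup>2 = 3 / 4"
proof -
  have 1: "(Re \<omega>)\<^sup>2 - (Im \<omega>)\<^sup>2 + Re \<omega> + 1 = 0"
    using arg_cong[OF omega_sum, of Re] by (simp add: power2_eq_square)
  have "Im \<omega> * (2 * Re \<omega> + 1) = 0"
    using arg_cong[OF omega_sum, of Im] by (simp add: power2_eq_square algebra_simps)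
  moreover have "Im \<omega> \<noteq> 0"
  proof
    assume "Im \<omega> = 0"
    hence "(Re \<omega> + 1 / 2)\<^sup>2 + 3 / 4 = 0" using 1 by (simp add: power2_eq_square algebra_simps)
    thus False using zero_le_power2[of "Re \<omega> + 1 / 2"] by linarith
  qed
  ultimately show Re: "Re \<omega> = - 1 / 2" by simp
  show "(Im \<omega>)\<^sup>2 = 3 / 4" using 1 unfolding Re by (simp add: power2_eq_square)
qed

text \<open>This is the norm form of the Eisenstein integers, scaled by
  \<open>\<omega>1\<close>.\<close>

lemma norm_real_combination_squared:
  "(norm (of_real a * \<omega>1 + of_real b * (\<omega> * \<omega>1)))\<^sup>2 = (a\<^sup>2 - a * b + b\<^sup>2) * (norm \<omega>1)\<^sup>2"
proof -
  have "of_real a * \<omega>1 + of_real b * (\<omega> * \<omega>1) = (of_real a + of_real b * \<omega>) * \<omega>1"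
    by (simp add: algebra_simps)
  moreover have "(norm (of_real a + of_real b * \<omega>))\<^sup>2 = (a + b * Re \<omega>)\<^sup>2 + b\<^sup>2 * (Im \<omega>)\<^sup>2"
    by (simp add: cmod_power2 power_mult_distrib)
  moreover have "\<dots> = a\<^sup>2 - a * b + b\<^sup>2"
    unfolding Re_omega Im_omega_squared by (simp add: power2_eq_square algebra_simps)
  ultimately show ?thesis
    by (simp add: norm_mult power_mult_distrib)
qed

text \<open>The norm form exceeds half of the Euclidean form by \<open>(m - n)^2 / 2\<close>. This
  comparison yields discreteness, uniqueness of coordinates and convergence of the lattice
  sums.\<close>

lemma norm_lattice_squared_ge:
  fixes m n :: int
  shows "(norm (of_int m * \<omega>1 + of_int n * (\<omega> * \<omega>1)))\<^sup>2
           \<ge> (of_int m ^ 2 + of_int n ^ 2) / 2 * (norm \<omega>1)\<^sup>2"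
proof -
  have "(real_of_int m)\<^sup>2 - of_int m * of_int n + (of_int n)\<^sup>2
          - (of_int m ^ 2 + of_int n ^ 2) / 2 = (real_of_int m - of_int n)\<^sup>2 / 2"
    by (simp add: power2_eq_square field_simps)
  moreover have "(real_of_int m - of_int n)\<^sup>2 / 2 \<ge> 0" by simp
  ultimately have "(real_of_int m)\<^sup>2 - of_int m * of_int n + (of_int n)\<^sup>2
          \<ge> (of_int m ^ 2 + of_int n ^ 2) / 2"
    by linarith
  hence "(of_int m ^ 2 + of_int n ^ 2) / 2 * (norm \<omega>1)\<^sup>2
           \<le> ((real_of_int m)\<^sup>2 - of_int m * of_int n + (of_int n)\<^sup>2) * (norm \<omega>1)\<^sup>2"
    by (rule mult_right_mono) simp
  thus ?thesis
    using norm_real_combination_squared[of "of_int m" "of_int n"] by simp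
qed

lemma lattice_0: "0 \<in> L"
  unfolding lattice_of_def by (auto intro!: exI[of _ "0::int"])

lemma lattice_add: "a \<in> L \<Longrightarrow> b \<in> L \<Longrightarrow> a + b \<in> L"
  unfolding lattice_of_def
proof clarify
  fix m n m' n' :: int
  show "\<exists>ma na. of_int m * \<omega>1 + of_int n * (\<omega> * \<omega>1) + (of_int m' * \<omega>1 + of_int n' * (\<omega> * \<omega>1)) =
          of_int ma * \<omega>1 + of_int na * (\<omega> * \<omega>1) \<and> True"
    by (intro exI[of _ "m + m'"] exI[of _ "n + n'"]) (simp add: algebra_simps)
qed

lemma lattice_minus: "a \<in> L \<Longrightarrow> - a \<in> L"
  unfolding lattice_of_def
proof clarify
  fix m n :: int
  show "\<exists>ma na. - (of_int m * \<omega>1 + of_int n * (\<omega> * \<omega>1)) =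
          of_int ma * \<omega>1 + of_int na * (\<omega> * \<omega>1) \<and> True"
    by (intro exI[of _ "- m"] exI[of _ "- n"]) (simp add: algebra_simps)
qed

lemma lattice_diff: "a \<in> L \<Longrightarrow> b \<in> L \<Longrightarrow> a - b \<in> L"
  using lattice_add[of a "- b"] lattice_minus[of b] by simp

text \<open>Here the hexagonal shape enters: \<open>\<omega>^2 = -1 - \<omega>\<close> rewrites the
  product in the same basis.\<close>

lemma lattice_omega: "a \<in> L \<Longrightarrow> \<omega> * a \<in> L"
  unfolding lattice_of_def
proof clarify
  fix m n :: int
  have "\<omega> * (of_int m * \<omega>1 + of_int n * (\<omega> * \<omega>1)) = of_int m * (\<omega> * \<omega>1) + of_int n * (\<omega>\<^sup>2 * \<omega>1)"
    by (simp add: algebra_simps power2_eq_square)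
  also have "\<dots> = of_int (- n) * \<omega>1 + of_int (m - n) * (\<omega> * \<omega>1)"
    unfolding omega_squared by (simp add: algebra_simps)
  finally show "\<exists>ma na. \<omega> * (of_int m * \<omega>1 + of_int n * (\<omega> * \<omega>1)) =
          of_int ma * \<omega>1 + of_int na * (\<omega> * \<omega>1) \<and> True"
    by blast
qed

lemma omega_mult_lattice_iff: "\<omega> * a \<in> L \<longleftrightarrow> a \<in> L"
proof
  assume "\<omega> * a \<in> L"
  hence "\<omega> * (\<omega> * (\<omega> * a)) \<in> L" by (rule lattice_omega[OF lattice_omega])
  moreover have "\<omega> * (\<omega> * (\<omega> * a)) = \<omega> ^ 3 * a" by (simp add: power3_eq_cube mult.assoc)
  ultimately show "a \<in> L" unfolding omega_cubed by simp
qed (rule lattice_omega)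

lemma minus_lattice_iff: "- a \<in> L \<longleftrightarrow> a \<in> L"
  using lattice_minus[of a] lattice_minus[of "- a"] by auto

lemma add_lattice_iff: "l \<in> L \<Longrightarrow> a + l \<in> L \<longleftrightarrow> a \<in> L"
  using lattice_add[of a l] lattice_diff[of "a + l" l] by auto

lemma finite_lattice_cball: "finite (L \<inter> cball 0 R)"
proof -
  define N where "N = \<lceil>2 * R / norm \<omega>1\<rceil>"
  have "L \<inter> cball 0 R \<subseteq> (\<lambda>(m, n). of_int m * \<omega>1 + of_int n * (\<omega> * \<omega>1)) ` ({-N..N} \<times> {-N..N})"
  proof
    fix l assume l: "l \<in> L \<inter> cball 0 R"
    then obtain m n :: int where l_eq: "l = of_int m * \<omega>1 + of_int n * (\<omega> * \<omega>1)"
      by (auto simp: lattice_of_def)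
    from l have "norm l \<le> R" by simp
    \<comment> \<open>Used for \<open>k = m\<close> and \<open>k = n\<close>. The estimate gives k^2
      |\<omega>1|^2 \<le> 2 R^2, which is weakened to (2 R)^2 so that the root can be taken.\<close>
    have *: "\<bar>k\<bar> \<le> N" if "k\<^sup>2 \<le> m\<^sup>2 + n\<^sup>2" for k :: int
    proof -
      from that have "real_of_int (k\<^sup>2) \<le> real_of_int (m\<^sup>2 + n\<^sup>2)" by linarith
      hence "(of_int k)\<^sup>2 / 2 * (norm \<omega>1)\<^sup>2 \<le> (of_int m ^ 2 + of_int n ^ 2) / 2 * (norm \<omega>1)\<^sup>2"
        by (intro mult_right_mono) auto
      also have "\<dots> \<le> (norm l)\<^sup>2" unfolding l_eq by (rule norm_lattice_squared_ge)
      also have "\<dots> \<le> R\<^sup>2" using \<open>norm l \<le> R\<close> by (intro power_mono) auto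
      finally have "(of_int k)\<^sup>2 * (norm \<omega>1)\<^sup>2 \<le> 2 * R\<^sup>2" by simp
      also have "\<dots> \<le> (2 * R)\<^sup>2" by (simp add: power2_eq_square)
      finally have "(of_int \<bar>k\<bar> * norm \<omega>1)\<^sup>2 \<le> (2 * R)\<^sup>2" by (simp add: power_mult_distrib)
      moreover have "0 \<le> 2 * R" using \<open>norm l \<le> R\<close> norm_ge_zero[of l] by linarith
      ultimately have "of_int \<bar>k\<bar> * norm \<omega>1 \<le> 2 * R"
        by (rule power2_le_imp_le)
      hence "of_int \<bar>k\<bar> \<le> 2 * R / norm \<omega>1" using omega1_nz by (simp add: field_simps)
      thus ?thesis unfolding N_def by linarith
    qed
    have "\<bar>m\<bar> \<le> N" "\<bar>n\<bar> \<le> N" by (auto intro!: *)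
    thus "l \<in> (\<lambda>(m, n). of_int m * \<omega>1 + of_int n * (\<omega> * \<omega>1)) ` ({-N..N} \<times> {-N..N})"
      unfolding l_eq by force
  qed
  thus ?thesis by (rule finite_subset) auto
qed

text \<open>A limit point would put infinitely many lattice points into a unit ball. Arbitrary
  subsets are allowed in order to cover both \<open>L\<close> and \<open>L - {0}\<close>.\<close>

lemma not_islimpt_lattice: "S \<subseteq> L \<Longrightarrow> \<not> z islimpt S"
proof
  assume "S \<subseteq> L" "z islimpt S"
  hence "infinite (L \<inter> ball z 1)"
    by (meson islimpt_eq_infinite_ball islimpt_subset zero_less_one)
  moreover have "L \<inter> ball z 1 \<subseteq> L \<inter> cball 0 (norm z + 1)"
    by (auto simp: dist_norm) (smt (verit) norm_minus_commute norm_triangle_sub)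
  ultimately show False
    using finite_lattice_cball finite_subset by blast
qed

lemma closed_lattice: "S \<subseteq> L \<Longrightarrow> closed S"
  using not_islimpt_lattice closed_limpt by blast

lemma eventually_not_in_lattice: "eventually (\<lambda>w. w \<notin> L) (at z)"
  using not_islimpt_lattice[of L z] by (simp add: islimpt_iff_eventually)

lemma countable_lattice: "countable L"
proof -
  have "L = (\<lambda>(m, n). of_int m * \<omega>1 + of_int n * (\<omega> * \<omega>1)) ` (UNIV \<times> UNIV)"
    by (auto simp: lattice_of_def)
  thus ?thesis by simp
qed

text \<open>Removing a countable set does not disconnect the plane. Connectedness is what makes a
  vanishing derivative force constancy and what the identity theorem rests on.\<close>

lemma connected_Compl_lattice: "connected (- L)"
  using connected_open_diff_countable[of "UNIV :: complex set" L] countable_lattice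
  by (simp add: Compl_eq_Diff_UNIV connected_UNIV)

text \<open>Integer coordinates that are not both 0 have m^2 + n^2 \<ge> 1. The factor 1/2 is cruder
  than the 1/sqrt 2 obtained this way, but avoids a root.\<close>

lemma norm_lattice_ge: "l \<in> L - {0} \<Longrightarrow> norm l \<ge> norm \<omega>1 / 2"
proof -
  assume "l \<in> L - {0}"
  then obtain m n :: int where l_eq: "l = of_int m * \<omega>1 + of_int n * (\<omega> * \<omega>1)" and nz: "l \<noteq> 0"
    by (auto simp: lattice_of_def)
  hence "m \<noteq> 0 \<or> n \<noteq> 0" by auto
  hence "m\<^sup>2 + n\<^sup>2 \<ge> 1"
    using sum_power2_gt_zero_iff[of m n] by linarith
  hence "real_of_int (m\<^sup>2 + n\<^sup>2) \<ge> 1" by linarith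
  hence "1 / 2 * (norm \<omega>1)\<^sup>2 \<le> (of_int m ^ 2 + of_int n ^ 2) / 2 * (norm \<omega>1)\<^sup>2"
    by (intro mult_right_mono) auto
  also have "\<dots> \<le> (norm l)\<^sup>2" unfolding l_eq by (rule norm_lattice_squared_ge)
  finally have "1 / 2 * (norm \<omega>1)\<^sup>2 \<le> (norm l)\<^sup>2" .
  moreover have "(norm \<omega>1 / 2)\<^sup>2 = 1 / 4 * (norm \<omega>1)\<^sup>2" by (simp add: power_divide)
  ultimately have "(norm \<omega>1 / 2)\<^sup>2 \<le> (norm l)\<^sup>2"
    using zero_le_power2[of "norm \<omega>1"] by linarith
  thus ?thesis by (rule power2_le_imp_le) auto
qed

section \<open>Absolute convergence of the lattice sums\<close>

text \<open>The squared norm dominates a multiple of (1 + |m|)(1 + |n|). Raising this to the power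
  3/2 bounds the terms by a product of two summable series in \<open>m\<close> and
  \<open>n\<close>.\<close>

lemma summable_norm_lattice_cubed: "(\<lambda>l. 1 / norm l ^ 3) summable_on (L - {0})"
proof -
  define g :: "int \<times> int \<Rightarrow> complex" where "g = (\<lambda>(m, n). of_int m * \<omega>1 + of_int n * (\<omega> * \<omega>1))"
  define S where "S = (UNIV :: (int \<times> int) set) - {(0, 0)}"
  have sq: "(norm (g (m, n)))\<^sup>2 \<ge> (of_int m ^ 2 + of_int n ^ 2) / 2 * (norm \<omega>1)\<^sup>2" for m n
    unfolding g_def using norm_lattice_squared_ge by simp
  have g_nz: "g x \<noteq> 0" if "x \<noteq> (0, 0)" for x
  proof
    obtain m n where x: "x = (m, n)" by force
    assume "g x = 0"
    hence "(of_int m ^ 2 + of_int n ^ 2) / 2 * (norm \<omega>1)\<^sup>2 \<le> 0" using sq[of m n] by (simp add: x)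
    hence "(real_of_int m ^ 2 + of_int n ^ 2) \<le> 0"
      using omega1_nz by (simp add: mult_le_0_iff)
    thus False using that x by (simp add: sum_power2_le_zero_iff)
  qed
  have inj: "inj g"
  proof (rule injI)
    fix x y assume "g x = g y"
    hence "g (x - y) = 0" by (auto simp: g_def case_prod_unfold algebra_simps)
    hence "x - y = (0, 0)" using g_nz by blast
    thus "x = y" by (simp add: prod_eq_iff)
  qed
  have img: "L - {0} = g ` S"
  proof -
    have "L = range g" by (auto simp: lattice_of_def g_def)
    moreover have "g (0, 0) = 0" by (simp add: g_def)
    ultimately show ?thesis using g_nz unfolding S_def by (auto simp: image_iff)
  qed
  define a where "a = (\<lambda>m::int. (1 + real_of_int \<bar>m\<bar>) powr -(3/2))"
  have a: "a summable_on UNIV" unfolding a_def by (rule summable_on_int_powr) simp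
  have "(\<lambda>(m, n). a m * a n) summable_on (UNIV \<times> UNIV)"
  proof (rule summable_on_SigmaI)
    show "((\<lambda>n. (case (m, n) of (m, n) \<Rightarrow> a m * a n)) has_sum (a m * infsum a UNIV)) UNIV" for m
      using has_sum_cmult_right[OF has_sum_infsum[OF a]] by simp
    show "(\<lambda>m. a m * infsum a UNIV) summable_on UNIV"
      by (rule summable_on_cmult_left[OF a])
  qed (auto simp: a_def)
  hence "(\<lambda>(m, n). a m * a n) summable_on S"
    by (rule summable_on_subset_banach) (auto simp: S_def)
  \<comment> \<open>The constant 5 / |\<omega>1|^2 of the quadratic comparison below, raised to the
    power 3/2.\<close>
  define C where "C = (5 / (norm \<omega>1)\<^sup>2) powr (3/2)"
  have "(\<lambda>x. C * (case x of (m, n) \<Rightarrow> a m * a n)) summable_on S"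
    by (rule summable_on_cmult_right) fact
  hence "(\<lambda>x. 1 / norm (g x) ^ 3) summable_on S"
  proof (rule summable_on_comparison_test)
    fix x assume "x \<in> S"
    obtain m n where x: "x = (m, n)" by force
    have nz: "(m, n) \<noteq> (0, 0)" using \<open>x \<in> S\<close> by (auto simp: S_def x)
    define s where "s = real_of_int (m\<^sup>2 + n\<^sup>2)"
    have "m\<^sup>2 + n\<^sup>2 \<ge> 1" using nz
      using sum_power2_gt_zero_iff[of m n] by auto
    hence s1: "s \<ge> 1" unfolding s_def by linarith
    define N where "N = norm (g x)"
    have "N > 0" using g_nz nz by (simp add: N_def x)
    have abs_le: "\<bar>real_of_int k\<bar> \<le> (real_of_int k)\<^sup>2" for k
    proof (cases "k = 0")
      case False
      hence "1 \<le> \<bar>real_of_int k\<bar>" by linarith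
      hence "\<bar>real_of_int k\<bar> * 1 \<le> \<bar>real_of_int k\<bar> * \<bar>real_of_int k\<bar>" by (intro mult_left_mono) auto
      thus ?thesis by (simp add: power2_eq_square abs_mult[symmetric])
    qed auto
    have "(1 + real_of_int \<bar>m\<bar>) * (1 + real_of_int \<bar>n\<bar>)
            = 1 + \<bar>real_of_int m\<bar> + \<bar>real_of_int n\<bar> + \<bar>real_of_int m\<bar> * \<bar>real_of_int n\<bar>"
      by (simp add: algebra_simps)
    \<comment> \<open>Integers satisfy |k| \<le> k^2, and the mixed term is at most
      \<open>s / 2\<close> by the arithmetic-geometric mean inequality. Since
      \<open>s \<ge> 1\<close>, the total is at most \<open>5 * (s / 2)\<close>.\<close>
    also have "\<dots> \<le> 1 + s + s / 2"
    proof -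
      have "1 + x + y + x * y \<le> 1 + (X + Y) + (X + Y) / 2"
        if "x \<le> X" "y \<le> Y" "x * y \<le> (X + Y) / 2" for x y X Y :: real
        using that by linarith
      from this[OF abs_le[of m] abs_le[of n]] show ?thesis
        using sum_squares_bound[of "\<bar>real_of_int m\<bar>" "\<bar>real_of_int n\<bar>"] by (simp add: s_def)
    qed
    also have "\<dots> \<le> 5 * (s / 2)" using s1 by simp
    also have "\<dots> \<le> 5 / (norm \<omega>1)\<^sup>2 * N\<^sup>2"
      using sq[of m n] omega1_nz by (simp add: N_def x s_def field_simps)
    finally have "((1 + real_of_int \<bar>m\<bar>) * (1 + real_of_int \<bar>n\<bar>)) powr (3/2)
                    \<le> (5 / (norm \<omega>1)\<^sup>2 * N\<^sup>2) powr (3/2)"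
      by (intro powr_mono2) auto
    also have "\<dots> = C * (N\<^sup>2) powr (3/2)"
      unfolding C_def by (rule powr_mult; simp)
    also have "(N\<^sup>2) powr (3/2) = N ^ 3"
      using \<open>N > 0\<close> by (simp add: powr_powr flip: powr_numeral)
    finally have *: "((1 + real_of_int \<bar>m\<bar>) * (1 + real_of_int \<bar>n\<bar>)) powr (3/2) \<le> C * N ^ 3" .
    have "1 / N ^ 3 \<le> C * (1 / ((1 + real_of_int \<bar>m\<bar>) * (1 + real_of_int \<bar>n\<bar>)) powr (3/2))"
    proof -
      have "1 / M \<le> C * (1 / t)" if "t \<le> C * M" "0 < t" "0 < M" for t M :: real
        using that by (simp add: field_simps)
      moreover have "(1 + real_of_int \<bar>m\<bar>) * (1 + real_of_int \<bar>n\<bar>) \<noteq> 0"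
        using abs_ge_zero[of m] abs_ge_zero[of n] by (smt (verit) mult_eq_0_iff of_int_0_le_iff)
      hence "((1 + real_of_int \<bar>m\<bar>) * (1 + real_of_int \<bar>n\<bar>)) powr (3/2) > 0"
        unfolding powr_gt_zero .
      moreover have "N ^ 3 > 0" using \<open>N > 0\<close> by simp
      ultimately show ?thesis using * by blast
    qed
    also have "1 / ((1 + real_of_int \<bar>m\<bar>) * (1 + real_of_int \<bar>n\<bar>)) powr (3/2) = a m * a n"
      unfolding a_def by (simp add: powr_mult powr_minus_divide)
    finally show "1 / norm (g x) ^ 3 \<le> C * (case x of (m, n) \<Rightarrow> a m * a n)"
      by (simp add: N_def x)
  qed auto
  moreover have "inj_on g S" using inj inj_on_subset by blast
  ultimately show ?thesis
    unfolding img by (subst summable_on_reindex) (auto simp: o_def)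
qed

section \<open>Analyticity and termwise differentiation of the Weierstrass function\<close>

text \<open>What remains of \<open>wp\<close> without its principal part at 0; it makes 0 a regular
  point.\<close>

definition wp_reg :: "complex \<Rightarrow> complex" where
  "wp_reg z = (\<Sum>\<^sub>\<infinity>l\<in>L - {0}. (1 / (z - l) ^ 2 - 1 / l ^ 2))"

lemma wp_eq: "wp z = 1 / z ^ 2 + wp_reg z"
  by (simp add: weierstrass_p_def wp_reg_def)

text \<open>A majorant for the Weierstrass M-test near \<open>z0\<close>, where
  \<open>z0 = 0\<close> is allowed. Subtracting \<open>1 / l^2\<close> leaves z (2 l - z) / (l^2 (z
  - l)^2), which decays like |l|^-3.\<close>

lemma wp_term_bound:
  assumes "z0 \<notin> L - {0}"
  obtains r C where "r > 0" "cball z0 r \<inter> (L - {0}) = {}"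
    "\<And>z l. z \<in> cball z0 r \<Longrightarrow> l \<in> L - {0} \<Longrightarrow>
       norm (1 / (z - l) ^ 2 - 1 / l ^ 2) \<le> C * (1 / norm l ^ 3)"
proof -
  have "open (- (L - {0}))" using closed_lattice[of "L - {0}"] by (auto simp: closed_def)
  then obtain e where e: "e > 0" "cball z0 e \<subseteq> - (L - {0})"
    using assms by (meson ComplI open_contains_cball)
  \<comment> \<open>Halving the radius keeps every \<open>z\<close> in the smaller ball at distance
    at least \<open>r\<close> from \<open>L - {0}\<close>.\<close>
  define r where "r = e / 2"
  have "r > 0" using e by (simp add: r_def)
  define R where "R = norm z0 + r"
  have "R > 0" using \<open>r > 0\<close> by (simp add: R_def add_nonneg_pos)
  \<comment> \<open>Chosen so that |z - l| \<ge> c |l| always: if |l| \<ge> 2 R the distance is at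
    least |l| / 2, and otherwise it is at least r = (r / (2 R)) * (2 R).\<close>
  define c where "c = min (1/2) (r / (2 * R))"
  have "c > 0" using \<open>r > 0\<close> \<open>R > 0\<close> by (simp add: c_def)
  \<comment> \<open>A lower bound for |l|, used to absorb |z| \<le> R into (R / m) |l|.\<close>
  define m where "m = norm \<omega>1 / 2"
  have "m > 0" using omega1_nz by (simp add: m_def)
  define C where "C = R * (2 + R / m) / c\<^sup>2"
  have "norm (1 / (z - l) ^ 2 - 1 / l ^ 2) \<le> C * (1 / norm l ^ 3)"
    if z: "z \<in> cball z0 r" and l: "l \<in> L - {0}" for z l
  proof -
    have nz: "norm z \<le> R"
      using z norm_triangle_sub[of z z0] by (simp add: R_def dist_norm norm_minus_commute)
    have "dist z0 l > e" using e l by (meson ComplD mem_cball not_le subsetD)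
    hence zl: "norm (z - l) \<ge> r"
      using z dist_triangle[of z0 l z] by (simp add: r_def dist_norm)
    have lm: "norm l \<ge> m" using norm_lattice_ge[OF l] by (simp add: m_def)
    have "l \<noteq> 0" "z \<noteq> l" using l zl \<open>r > 0\<close> by auto
    have zl': "norm (z - l) \<ge> c * norm l"
    proof (cases "norm l \<ge> 2 * R")
      case True
      have "c * norm l \<le> 1 / 2 * norm l" unfolding c_def by (intro mult_right_mono) auto
      also have "\<dots> \<le> norm l - norm z" using True nz by simp
      also have "\<dots> \<le> norm (z - l)" by (metis norm_minus_commute norm_triangle_ineq2)
      finally show ?thesis .
    next
      case False
      have "c * norm l \<le> r / (2 * R) * norm l" unfolding c_def by (intro mult_right_mono) auto
      also have "\<dots> \<le> r / (2 * R) * (2 * R)"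
        using False \<open>r > 0\<close> \<open>R > 0\<close> by (intro mult_left_mono) auto
      also have "\<dots> = r" using \<open>R > 0\<close> by simp
      finally show ?thesis using zl by simp
    qed
    have "1 / (z - l) ^ 2 - 1 / l ^ 2 = z * (2 * l - z) / (l\<^sup>2 * (z - l)\<^sup>2)"
      using \<open>l \<noteq> 0\<close> \<open>z \<noteq> l\<close> by (simp add: divide_simps) (simp add: power2_eq_square algebra_simps)
    hence "norm (1 / (z - l) ^ 2 - 1 / l ^ 2)
             = norm z * norm (2 * l - z) / ((norm l)\<^sup>2 * (norm (z - l))\<^sup>2)"
      by (simp add: norm_mult norm_divide norm_power)
    also have "\<dots> \<le> (R * ((2 + R / m) * norm l)) / ((norm l)\<^sup>2 * (c * norm l)\<^sup>2)"
    proof (rule frac_le)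
      have "norm (2 * l - z) \<le> 2 * norm l + norm z"
        using norm_triangle_ineq4[of "2 * l" z] by (simp add: norm_mult)
      also have "norm z \<le> R / m * m" using nz \<open>m > 0\<close> by simp
      also have "\<dots> \<le> R / m * norm l" using lm \<open>R > 0\<close> \<open>m > 0\<close> by (intro mult_left_mono) auto
      finally have "norm (2 * l - z) \<le> (2 + R / m) * norm l" by (simp add: algebra_simps)
      thus "norm z * norm (2 * l - z) \<le> R * ((2 + R / m) * norm l)"
        using nz \<open>R > 0\<close> by (intro mult_mono) auto
      show "(norm l)\<^sup>2 * (c * norm l)\<^sup>2 \<le> (norm l)\<^sup>2 * (norm (z - l))\<^sup>2"
        using zl' \<open>c > 0\<close> by (intro mult_left_mono power_mono) auto
      show "0 < (norm l)\<^sup>2 * (c * norm l)\<^sup>2" using \<open>l \<noteq> 0\<close> \<open>c > 0\<close> by simp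
      show "0 \<le> R * ((2 + R / m) * norm l)" using \<open>R > 0\<close> \<open>m > 0\<close> by simp
    qed
    also have "\<dots> = C * (1 / norm l ^ 3)"
      using \<open>l \<noteq> 0\<close> \<open>c > 0\<close>
      by (simp add: C_def divide_simps power2_eq_square power3_eq_cube)
    finally show ?thesis .
  qed
  moreover have "cball z0 r \<inter> (L - {0}) = {}"
    using e subset_cball[of r e z0] by (auto simp: r_def)
  ultimately show ?thesis by (intro that[of r C] \<open>r > 0\<close>)
qed

text \<open>The M-test makes the finite partial sums converge uniformly near \<open>z0\<close>.
  Hence the limit is holomorphic and the derivatives of the partial sums converge to its
  derivative.\<close>

lemma wp_reg_local:
  assumes "z0 \<notin> L - {0}"
  shows wp_reg_analytic: "wp_reg analytic_on {z0}"
    and has_sum_deriv_wp_reg: "((\<lambda>l. - 2 / (z0 - l) ^ 3) has_sum deriv wp_reg z0) (L - {0})"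
proof -
  obtain r C where r: "r > 0" and disj: "cball z0 r \<inter> (L - {0}) = {}"
    and bound: "\<And>z l. z \<in> cball z0 r \<Longrightarrow> l \<in> L - {0} \<Longrightarrow>
       norm (1 / (z - l) ^ 2 - 1 / l ^ 2) \<le> C * (1 / norm l ^ 3)"
    using wp_term_bound[OF assms] by metis
  let ?F = "finite_subsets_at_top (L - {0})"
  let ?S = "\<lambda>X z. \<Sum>l\<in>X. (1 / (z - l) ^ 2 - 1 / l ^ 2)"
  have ul: "uniform_limit (cball z0 r) ?S wp_reg ?F"
    unfolding wp_reg_def
    using bound summable_on_cmult_right[OF summable_norm_lattice_cubed, of C]
    by (intro Weierstrass_m_test_general) auto
  have ev: "eventually (\<lambda>X. finite X \<and> X \<subseteq> L - {0}) ?F"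
    by (simp add: eventually_finite_subsets_at_top_weakI)
  have holo: "?S X holomorphic_on cball z0 r" if "X \<subseteq> L - {0}" for X
    using that disj by (intro holomorphic_intros) auto
  have "eventually (\<lambda>X. continuous_on (cball z0 r) (?S X) \<and> ?S X holomorphic_on ball z0 r) ?F"
    using ev
  proof eventually_elim
    case (elim X)
    have *: "?S X holomorphic_on cball z0 r" by (rule holo) (use elim in auto)
    show ?case
      using holomorphic_on_imp_continuous_on[OF *] holomorphic_on_subset[OF * ball_subset_cball]
      by blast
  qed
  then obtain "wp_reg holomorphic_on ball z0 r"
    by (rule holomorphic_uniform_limit[OF _ ul]) auto
  thus "wp_reg analytic_on {z0}"
    using r by (meson analytic_at centre_in_ball open_ball)
  have "((\<lambda>X. deriv (?S X) z0) \<longlongrightarrow> deriv wp_reg z0) ?F"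
  proof (rule deriv_complex_uniform_limit)
    show "uniform_limit (ball z0 r) ?S wp_reg ?F"
      by (rule uniform_limit_on_subset[OF ul]) auto
    show "eventually (\<lambda>X. ?S X holomorphic_on ball z0 r) ?F"
      using ev by eventually_elim (rule holomorphic_on_subset[OF holo ball_subset_cball], simp)
  qed (use r in auto)
  moreover have "eventually (\<lambda>X. deriv (?S X) z0 = (\<Sum>l\<in>X. - 2 / (z0 - l) ^ 3)) ?F"
    using ev
  proof eventually_elim
    case (elim X)
    have "((\<lambda>z. 1 / (z - l) ^ 2 - 1 / l ^ 2) has_field_derivative (- 2 / (z0 - l) ^ 3)) (at z0)"
      if "l \<in> X" for l
    proof -
      have "l \<in> L - {0}" using that elim by auto
      hence "z0 \<noteq> l" using assms by auto
      thus ?thesis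
        using DERIV_diff[OF DERIV_inverse_square DERIV_const] by fastforce
    qed
    hence "(?S X has_field_derivative (\<Sum>l\<in>X. - 2 / (z0 - l) ^ 3)) (at z0)"
      by (intro DERIV_sum) auto
    thus ?case by (rule DERIV_imp_deriv)
  qed
  ultimately show "((\<lambda>l. - 2 / (z0 - l) ^ 3) has_sum deriv wp_reg z0) (L - {0})"
    unfolding has_sum_def by (rule Lim_transform_eventually)
qed

lemma wp_analytic: "wp analytic_on - L"
proof -
  have "wp_reg analytic_on - L"
    using wp_reg_analytic by (subst analytic_on_analytic_at) auto
  hence "(\<lambda>z. 1 / z ^ 2 + wp_reg z) analytic_on - L"
    using lattice_0 by (intro analytic_intros) auto
  thus ?thesis by (simp add: wp_eq[abs_def])
qed

lemma DERIV_wp: "z \<notin> L \<Longrightarrow> (wp has_field_derivative deriv wp z) (at z)"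
  using analytic_on_imp_differentiable_at[OF wp_analytic, of z]
  by (simp add: field_differentiable_derivI)

lemma deriv_wp_eq:
  assumes "z \<notin> L - {0}" "z \<noteq> 0"
  shows "deriv wp z = - 2 / z ^ 3 + deriv wp_reg z"
proof -
  have "wp_reg field_differentiable at z"
    by (rule analytic_on_imp_differentiable_at[OF wp_reg_analytic[OF assms(1)]]) auto
  hence "(wp_reg has_field_derivative deriv wp_reg z) (at z)"
    by (simp add: field_differentiable_derivI)
  hence "((\<lambda>z. 1 / z ^ 2 + wp_reg z) has_field_derivative (- 2 / z ^ 3 + deriv wp_reg z)) (at z)"
    using DERIV_add[OF DERIV_inverse_square[of z 0]] assms(2) by simp
  thus ?thesis unfolding wp_eq[abs_def] by (rule DERIV_imp_deriv)
qed

text \<open>The derivative of \<open>1 / z^2\<close> is exactly the missing term for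
  \<open>l = 0\<close>. The sum then runs over all of \<open>L\<close>, without correction
  terms.\<close>

lemma has_sum_deriv_wp:
  assumes "z \<notin> L"
  shows "((\<lambda>l. - 2 / (z - l) ^ 3) has_sum deriv wp z) L"
proof -
  have z: "z \<noteq> 0" using assms lattice_0 by auto
  have "((\<lambda>l. - 2 / (z - l) ^ 3) has_sum (- 2 / (z - 0) ^ 3 + deriv wp_reg z)) (insert 0 (L - {0}))"
    by (rule has_sum_insert[OF _ has_sum_deriv_wp_reg]) (use assms in auto)
  thus ?thesis
    using assms z lattice_0 by (simp add: deriv_wp_eq insert_absorb)
qed

section \<open>Translations, reflection and rotation\<close>

text \<open>A translation of the argument by \<open>l\<close> is a reindexing of the sum over
  \<open>L\<close>.\<close>

lemma deriv_wp_periodic: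
  assumes "l \<in> L" "z \<notin> L"
  shows "deriv wp (z + l) = deriv wp z"
proof -
  have "((\<lambda>k. - 2 / (z + l - k) ^ 3) has_sum deriv wp (z + l)) L"
    using assms by (intro has_sum_deriv_wp) (simp add: add_lattice_iff)
  also have "?this \<longleftrightarrow> ((\<lambda>k. - 2 / (z - k) ^ 3) has_sum deriv wp (z + l)) L"
    by (rule has_sum_reindex_bij_witness[of _ "\<lambda>k. k + l" "\<lambda>k. k - l"])
       (use assms in \<open>auto simp: lattice_diff lattice_add algebra_simps\<close>)
  finally show ?thesis
    using has_sum_deriv_wp[OF assms(2)] has_sum_unique by blast
qed

text \<open>The terms for \<open>l\<close> and \<open>- l\<close> correspond one by one, so the
  identity holds at lattice points too, with 1/0 = 0.\<close>

lemma wp_reg_minus: "wp_reg (- z) = wp_reg z"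
  unfolding wp_reg_def
  by (rule infsum_reindex_bij_witness[of _ uminus uminus])
     (auto simp: lattice_minus power2_commute power2_eq_square algebra_simps)

lemma wp_minus: "wp (- z) = wp z"
  by (simp add: wp_eq wp_reg_minus)

lemma inverse_omega_squared: "1 / (\<omega> * z) ^ 2 = \<omega> * (1 / z ^ 2)"
proof -
  have "\<omega> ^ 2 * \<omega> = 1" using omega_cubed by (simp add: power2_eq_square power3_eq_cube)
  thus ?thesis using omega_nz by (cases "z = 0") (simp_all add: power_mult_distrib field_simps)
qed

text \<open>Rotation permutes \<open>L - {0}\<close>, and 1 / \<omega>^2 = \<omega> turns each term
  into \<omega> times the rotated one.\<close>

lemma wp_reg_omega: "wp_reg (\<omega> * z) = \<omega> * wp_reg z"
proof -
  have "wp_reg (\<omega> * z) = (\<Sum>\<^sub>\<infinity>l\<in>L - {0}. \<omega> * (1 / (z - l) ^ 2 - 1 / l ^ 2))"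
    unfolding wp_reg_def
  proof (rule infsum_reindex_bij_witness[of _ "\<lambda>l. \<omega> * l" "\<lambda>l. l / \<omega>"])
    fix l assume l: "l \<in> L - {0}"
    show "l / \<omega> \<in> L - {0}"
      using l omega_mult_lattice_iff[of "l / \<omega>"] omega_nz by auto
    show "\<omega> * (1 / (z - l / \<omega>) ^ 2 - 1 / (l / \<omega>) ^ 2) = 1 / (\<omega> * z - l) ^ 2 - 1 / l ^ 2"
      unfolding right_diff_distrib inverse_omega_squared[symmetric]
      using omega_nz by (simp add: right_diff_distrib)
  qed (use omega_nz in \<open>auto simp: omega_mult_lattice_iff\<close>)
  also have "\<dots> = \<omega> * wp_reg z" unfolding wp_reg_def by (rule infsum_cmult_right')
  finally show ?thesis .
qed

lemma wp_omega: "wp (\<omega> * z) = \<omega> * wp z"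
  unfolding wp_eq wp_reg_omega inverse_omega_squared by (simp add: algebra_simps)

text \<open>By periodicity of the derivative, the difference \<open>D\<close> is constant on the
  connected complement of \<open>L\<close>; evenness shows that this constant equals its own
  negative.\<close>

lemma wp_periodic:
  assumes "l \<in> L" "z \<notin> L"
  shows "wp (z + l) = wp z"
proof -
  define D where "D = (\<lambda>z. wp (z + l) - wp z)"
  have "D constant_on - L"
  proof (rule has_field_derivative_0_imp_constant_on)
    show "connected (- L)" by (rule connected_Compl_lattice)
    show "open (- L)" using closed_lattice by (simp add: open_closed)
    fix z assume z: "z \<in> - L"
    hence "(wp has_field_derivative deriv wp z) (at (z + l))"
      using DERIV_wp[of "z + l"] assms(1) by (simp add: add_lattice_iff deriv_wp_periodic)
    hence "((\<lambda>z. wp (z + l)) has_field_derivative deriv wp z) (at z)"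
      by (simp add: DERIV_shift)
    from DERIV_diff[OF this DERIV_wp[of z]] show "(D has_field_derivative 0) (at z)"
      using z by (simp add: D_def)
  qed
  then obtain c where c: "wp (z + l) - wp z = c" if "z \<notin> L" for z
    unfolding D_def constant_on_def by auto
  \<comment> \<open>At this point \<open>D\<close> takes the value wp z - wp (z + l), which is the
    negative of its value at \<open>z\<close>.\<close>
  have "- z - l \<notin> L"
    using assms minus_lattice_iff[of "z + l"] by (simp add: add_lattice_iff)
  from c[OF this] have "wp z - wp (z + l) = c"
    using wp_minus[of z] wp_minus[of "z + l"] by simp
  with c[OF assms(2)] have "wp (z + l) - wp z = wp z - wp (z + l)" by metis
  hence "2 * wp (z + l) = 2 * wp z" by algebra
  thus ?thesis by simp
qed

text \<open>Differentiates the functional equation; the cases of interest are \<open>c = -1\<close>,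
  \<open>d = 1\<close> and \<open>c = d = \<omega>\<close>.\<close>

lemma deriv_wp_scale:
  assumes "\<And>z. wp (c * z) = d * wp z" "z \<notin> L" "c * z \<notin> L"
  shows "c * deriv wp (c * z) = d * deriv wp z"
proof -
  have "((\<lambda>z. wp (c * z)) has_field_derivative (deriv wp (c * z) * c)) (at z)"
    by (rule DERIV_chain2[where f = wp and g = "\<lambda>z. c * z", OF DERIV_wp[OF assms(3)]]) (auto intro!: derivative_eq_intros)
  moreover have "((\<lambda>z. wp (c * z)) has_field_derivative (d * deriv wp z)) (at z)"
    unfolding assms(1) by (intro DERIV_cmult DERIV_wp assms)
  ultimately show ?thesis by (metis DERIV_unique mult.commute)
qed

lemma deriv_wp_minus: "z \<notin> L \<Longrightarrow> deriv wp (- z) = - deriv wp z"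
  using deriv_wp_scale[of "-1" 1 z] by (simp add: wp_minus minus_lattice_iff minus_equation_iff)

lemma deriv_wp_omega: "z \<notin> L \<Longrightarrow> deriv wp (\<omega> * z) = deriv wp z"
  using deriv_wp_scale[of \<omega> \<omega> z] omega_nz by (simp add: wp_omega omega_mult_lattice_iff)

end

subsection \<open>Maps into the sphere\<close>

text \<open>Carries punctured neighbourhoods along an invertible affine map, so that limits and
  poles can be transported.\<close>

lemma filtermap_affine_at:
  fixes c :: "'a :: real_normed_field"
  assumes "c \<noteq> 0"
  shows "filtermap (\<lambda>z. c * z + d) (at a) = at (c * a + d)"
proof (rule filtermap_nhds_eq_imp_filtermap_at_eq)
  have "filtermap (\<lambda>z. c * z + d) (nhds a)
          = filtermap (\<lambda>x. x - (- d)) (filtermap (times c) (nhds a))"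
    by (simp add: filtermap_filtermap)
  also have "\<dots> = nhds (c * a + d)"
    unfolding filtermap_nhds_times[OF assms] filtermap_nhds_shift by simp
  finally show "filtermap (\<lambda>z. c * z + d) (nhds a) = nhds (c * a + d)" .
  show "eventually (\<lambda>x. c * x + d = c * a + d \<longrightarrow> x = a) (at a)" using assms by simp
qed

lemma to_sphere_cong:
  assumes "eventually (\<lambda>z. f z = g z) (at a)"
  shows "to_sphere f a = to_sphere g a"
  using is_pole_cong[OF assms refl] remove_sings_cong[OF assms refl] by (simp add: to_sphere_def)

text \<open>An identity near \<open>a\<close>, with \<open>a\<close> itself left out, yields
  equality of the sphere values at the points themselves, whatever values \<open>f\<close> has
  there.\<close>

lemma to_sphere_affine:
  assumes "c \<noteq> 0" "eventually (\<lambda>z. f (c * z + d) = f z) (at a)"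
  shows "to_sphere f (c * a + d) = to_sphere f a"
proof -
  have *: "filtermap (\<lambda>z. c * z + d) (at a) = at (c * a + d)"
    by (rule filtermap_affine_at) fact
  have "is_pole f (c * a + d) \<longleftrightarrow> is_pole (\<lambda>z. f (c * z + d)) a"
    unfolding is_pole_def filterlim_def *[symmetric] filtermap_filtermap ..
  moreover have "remove_sings f (c * a + d) = remove_sings (\<lambda>z. f (c * z + d)) a"
    using remove_sings_compose[OF *, of f] by (simp add: o_def)
  ultimately have "to_sphere f (c * a + d) = to_sphere (\<lambda>z. f (c * z + d)) a"
    by (simp add: to_sphere_def)
  also have "\<dots> = to_sphere f a" by (rule to_sphere_cong) fact
  finally show ?thesis .
qed

lemma to_sphere_remove_sings:
  assumes "f meromorphic_on UNIV"
  shows "to_sphere (remove_sings f) = to_sphere f"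
proof
  fix z
  have "isolated_singularity_at f z"
    using assms by (meson UNIV_I meromorphic_on_altdef)
  thus "to_sphere (remove_sings f) z = to_sphere f z"
    by (intro to_sphere_cong eventually_remove_sings_eq_at)
qed

text \<open>If both points are poles, both values are the default 0 of
  \<open>remove_sings\<close>.\<close>

lemma to_sphere_eq_imp_remove_sings_eq:
  "to_sphere f a = to_sphere f b \<Longrightarrow> remove_sings f a = remove_sings f b"
  by (auto simp: to_sphere_def split: if_splits)

subsection \<open>Bounds on the order of a pole\<close>

text \<open>An upper bound instead of the exact order: it covers functions vanishing near
  \<open>a\<close>, adds up under products, and ignores the value \<open>f a\<close>. The bound 0
  means a removable singularity.\<close>

definition pole_order_le :: "(complex \<Rightarrow> complex) \<Rightarrow> complex \<Rightarrow> nat \<Rightarrow> bool" where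
  "pole_order_le f a n \<longleftrightarrow>
     (\<exists>h. h analytic_on {a} \<and> eventually (\<lambda>z. f z * (z - a) ^ n = h z) (at a))"

lemma pole_order_leI:
  "h analytic_on {a} \<Longrightarrow> eventually (\<lambda>z. f z * (z - a) ^ n = h z) (at a) \<Longrightarrow> pole_order_le f a n"
  unfolding pole_order_le_def by blast

lemma pole_order_le_analytic: "f analytic_on {a} \<Longrightarrow> pole_order_le f a 0"
  by (rule pole_order_leI[of f]) auto

lemma pole_order_le_mult:
  assumes "pole_order_le f a m" "pole_order_le g a n"
  shows "pole_order_le (\<lambda>z. f z * g z) a (m + n)"
proof -
  obtain h k where h: "h analytic_on {a}" "eventually (\<lambda>z. f z * (z - a) ^ m = h z) (at a)"
    and k: "k analytic_on {a}" "eventually (\<lambda>z. g z * (z - a) ^ n = k z) (at a)"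
    using assms unfolding pole_order_le_def by blast
  show ?thesis
  proof (rule pole_order_leI)
    show "(\<lambda>z. h z * k z) analytic_on {a}" using h k by (intro analytic_intros)
    show "eventually (\<lambda>z. f z * g z * (z - a) ^ (m + n) = h z * k z) (at a)"
      using h(2) k(2) by eventually_elim (metis mult.assoc mult.left_commute power_add)
  qed
qed

text \<open>The bound \<open>m + n\<close> is coarser than the maximum, but agrees with it when one
  of the two is 0, as in all applications below.\<close>

lemma pole_order_le_add:
  assumes "pole_order_le f a m" "pole_order_le g a n"
  shows "pole_order_le (\<lambda>z. f z + g z) a (m + n)"
proof -
  obtain h k where h: "h analytic_on {a}" "eventually (\<lambda>z. f z * (z - a) ^ m = h z) (at a)"
    and k: "k analytic_on {a}" "eventually (\<lambda>z. g z * (z - a) ^ n = k z) (at a)"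
    using assms unfolding pole_order_le_def by blast
  show ?thesis
  proof (rule pole_order_leI)
    show "(\<lambda>z. h z * (z - a) ^ n + k z * (z - a) ^ m) analytic_on {a}"
      using h k by (intro analytic_intros)
    show "eventually (\<lambda>z. (f z + g z) * (z - a) ^ (m + n)
                        = h z * (z - a) ^ n + k z * (z - a) ^ m) (at a)"
      using h(2) k(2)
    proof eventually_elim
      case (elim z)
      show ?case unfolding elim[symmetric] by (simp add: power_add algebra_simps)
    qed
  qed
qed

text \<open>Any multiple of \<open>m\<close> serves as a bound; in particular \<open>m = 0\<close>
  is preserved.\<close>

lemma pole_order_le_poly:
  assumes "pole_order_le f a m"
  shows "\<exists>k. pole_order_le (\<lambda>z. poly p (f z)) a (k * m)"
proof (induction p)
  case 0
  have "pole_order_le (\<lambda>z. poly 0 (f z)) a (0 * m)"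
    by (auto intro: pole_order_le_analytic)
  thus ?case by blast
next
  case (pCons c p)
  then obtain k where "pole_order_le (\<lambda>z. poly p (f z)) a (k * m)" by blast
  with assms have "pole_order_le (\<lambda>z. f z * poly p (f z)) a (m + k * m)"
    by (rule pole_order_le_mult)
  moreover have "pole_order_le (\<lambda>_. c) a 0" by (auto intro: pole_order_le_analytic)
  ultimately have "pole_order_le (\<lambda>z. c + f z * poly p (f z)) a (0 + (m + k * m))"
    by (intro pole_order_le_add)
  hence "pole_order_le (\<lambda>z. poly (pCons c p) (f z)) a (Suc k * m)" by simp
  thus ?case by blast
qed

text \<open>Read off from the factorisation of \<open>f\<close> as
  \<open>g w * (w - a) powi k\<close>. A function vanishing near \<open>a\<close> has no such order
  and is treated separately.\<close>

lemma pole_order_le_meromorphic: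
  assumes "f meromorphic_on {a}"
  shows "\<exists>n. pole_order_le f a n"
proof (cases "frequently (\<lambda>z. f z \<noteq> 0) (at a)")
  case True
  define g where "g = zor_poly f a"
  define k where "k = zorder f a"
  obtain r where r: "r > 0" "g holomorphic_on cball a r"
    "\<And>w. w \<in> cball a r - {a} \<Longrightarrow> f w = g w * (w - a) powi k"
    using zorder_exist[of f a] assms True unfolding meromorphic_at_iff g_def k_def by blast
  have g: "g analytic_on {a}"
    using r by (meson analytic_at ball_subset_cball centre_in_ball holomorphic_on_subset open_ball)
  have ev: "eventually (\<lambda>w. w \<in> ball a r - {a}) (at a)"
    using r by (intro eventually_at_in_open) auto
  show ?thesis
  proof (cases "k \<ge> 0")
    case True
    have "pole_order_le f a 0"
    proof (rule pole_order_leI)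
      show "(\<lambda>w. g w * (w - a) ^ nat k) analytic_on {a}" using g by (intro analytic_intros)
      show "eventually (\<lambda>w. f w * (w - a) ^ 0 = g w * (w - a) ^ nat k) (at a)"
        using ev
      proof eventually_elim
        case (elim w)
        have "f w = g w * (w - a) powi k" using elim by (intro r) auto
        thus ?case using True by (simp add: power_int_def)
      qed
    qed
    thus ?thesis ..
  next
    case False
    have "pole_order_le f a (nat (- k))"
    proof (rule pole_order_leI[OF g])
      show "eventually (\<lambda>w. f w * (w - a) ^ nat (- k) = g w) (at a)"
        using ev
      proof eventually_elim
        case (elim w)
        have "f w = g w * (w - a) powi k" using elim by (intro r) auto
        thus ?case using False elim by (simp add: power_int_def power_inverse)
      qed
    qed
    thus ?thesis ..
  qed
next
  case False
  hence "eventually (\<lambda>z. f z = 0) (at a)" by (simp add: frequently_def)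
  hence "pole_order_le f a 0" by (intro pole_order_leI[of "\<lambda>_. 0"]) auto
  thus ?thesis ..
qed

lemma pole_order_le_imp_meromorphic:
  assumes "pole_order_le f a n"
  shows "f meromorphic_on {a}"
proof -
  obtain h where h: "h analytic_on {a}" "eventually (\<lambda>z. f z * (z - a) ^ n = h z) (at a)"
    using assms unfolding pole_order_le_def by blast
  have "(\<lambda>z. h z / (z - a) ^ n) meromorphic_on {a}"
    using h(1) by (intro meromorphic_intros analytic_on_imp_meromorphic_on)
  also have "eventually (\<lambda>z. z \<noteq> a) (at a)" by (simp add: eventually_at_filter)
  with h(2) have "eventually (\<lambda>z. h z / (z - a) ^ n = f z) (at a)"
    by eventually_elim (simp add: divide_eq_eq)
  hence "(\<lambda>z. h z / (z - a) ^ n) meromorphic_on {a} \<longleftrightarrow> f meromorphic_on {a}"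
    by (intro meromorphic_on_cong) auto
  finally show ?thesis .
qed

text \<open>The difference quotient has a removable singularity at \<open>a\<close>, filled by the
  derivative.\<close>

lemma analytic_difference_quotient:
  assumes "h analytic_on {a}"
  shows "\<exists>g. g analytic_on {a} \<and> (\<forall>z. h z - h a = (z - a) * g z)"
proof -
  define g where "g = (\<lambda>z. if z = a then deriv h a else (h z - h a) / (z - a))"
  have ana: "(\<lambda>z. h z - h a) analytic_on {a}" using assms by (intro analytic_intros)
  moreover have "deriv (\<lambda>z. h z - h a) a = deriv h a"
    using analytic_on_imp_differentiable_at[OF assms] by (simp add: deriv_diff)
  moreover have eq: "h z - h a = (z - a) * g z" for z by (simp add: g_def)
  ultimately have "g analytic_on {a}"
    by (intro pole_theorem_analytic_0[OF ana]) (simp_all add: g_def exI[of _ "1::real"])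
  with eq show ?thesis by blast
qed

text \<open>The value \<open>h a\<close> is the leading Laurent coefficient; when it vanishes, a
  factor \<open>z - a\<close> cancels.\<close>

lemma pole_order_le_reduce:
  assumes "h analytic_on {a}" "eventually (\<lambda>z. f z * (z - a) ^ Suc n = h z) (at a)" "h a = 0"
  shows "pole_order_le f a n"
proof -
  obtain g where g: "g analytic_on {a}" "\<And>z. h z - h a = (z - a) * g z"
    using analytic_difference_quotient[OF assms(1)] by blast
  have "eventually (\<lambda>z. z \<noteq> a) (at a)" by (simp add: eventually_at_filter)
  with assms(2) have "eventually (\<lambda>z. f z * (z - a) ^ n = g z) (at a)"
  proof eventually_elim
    case (elim z)
    have "(z - a) * (f z * (z - a) ^ n) = (z - a) * g z"
      using elim g(2)[of z] assms(3) by (simp add: algebra_simps)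
    thus ?case using elim by simp
  qed
  thus ?thesis by (rule pole_order_leI[OF g(1)])
qed

text \<open>\<open>Q z - Q a\<close> is divisible by \<open>z - a\<close>, so its
  \<open>n\<close>-th power cancels a pole of order at most \<open>n\<close>.\<close>

lemma pole_order_le_clear:
  assumes "pole_order_le f a n" "Q analytic_on {a}"
  shows "pole_order_le (\<lambda>z. (Q z - Q a) ^ n * f z) a 0"
proof -
  obtain g where g: "g analytic_on {a}" "\<And>z. Q z - Q a = (z - a) * g z"
    using analytic_difference_quotient[OF assms(2)] by blast
  obtain h where h: "h analytic_on {a}" "eventually (\<lambda>z. f z * (z - a) ^ n = h z) (at a)"
    using assms unfolding pole_order_le_def by blast
  show ?thesis
  proof (rule pole_order_leI)
    show "(\<lambda>z. g z ^ n * h z) analytic_on {a}" using g h by (intro analytic_intros)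
    show "eventually (\<lambda>z. (Q z - Q a) ^ n * f z * (z - a) ^ 0 = g z ^ n * h z) (at a)"
      using h(2)
    proof eventually_elim
      case (elim z)
      show ?case unfolding elim[symmetric] g(2) by (simp add: power_mult_distrib)
    qed
  qed
qed

lemma remove_sings_analytic_if_no_pole:
  assumes "f meromorphic_on {a}" "\<not> is_pole f a"
  shows "remove_sings f analytic_on {a}"
proof -
  obtain c where "f \<midarrow>a\<rightarrow> c" using assms by (auto simp: meromorphic_at_iff not_essential_def)
  thus ?thesis using assms by (auto simp: meromorphic_at_iff intro: remove_sings_analytic_at)
qed

lemma pole_order_le_0_iff:
  "pole_order_le f a 0 \<longleftrightarrow> f meromorphic_on {a} \<and> \<not> is_pole f a"
proof
  assume *: "pole_order_le f a 0"
  then obtain h where h: "h analytic_on {a}" "eventually (\<lambda>z. f z = h z) (at a)"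
    unfolding pole_order_le_def by auto
  have "\<not> is_pole h a" using h(1) by (rule analytic_at_imp_no_pole)
  hence "\<not> is_pole f a" using is_pole_cong[OF h(2) refl] by simp
  with pole_order_le_imp_meromorphic[OF *] show "f meromorphic_on {a} \<and> \<not> is_pole f a" by simp
next
  assume *: "f meromorphic_on {a} \<and> \<not> is_pole f a"
  hence "remove_sings f analytic_on {a}" by (blast intro: remove_sings_analytic_if_no_pole)
  moreover have "eventually (\<lambda>z. remove_sings f z = f z) (at a)"
    using * by (auto simp: meromorphic_at_iff intro: eventually_remove_sings_eq_at)
  ultimately show "pole_order_le f a 0"
    by (intro pole_order_leI) (auto elim: eventually_mono)
qed

lemma pole_order_le_0_imp_remove_sings_analytic:
  "pole_order_le f a 0 \<Longrightarrow> remove_sings f analytic_on {a}"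
  using remove_sings_analytic_if_no_pole pole_order_le_0_iff by blast

subsection \<open>Rational functions on the sphere\<close>

lemma to_sphere_eq_FiniteI: "f \<midarrow>a\<rightarrow> c \<Longrightarrow> to_sphere f a = Finite c"
  unfolding to_sphere_def is_pole_def
  by (auto simp: remove_sings_eqI dest: not_tendsto_and_filterlim_at_infinity[OF at_neq_bot])

text \<open>The limit is the finite value of \<open>rational_eval\<close> at \<open>Infty\<close>;
  its numerator is 0 when \<open>degree p < degree q\<close>.\<close>

lemma poly_quotient_tendsto_at_infinity:
  fixes p q :: "'a :: real_normed_field poly"
  assumes "q \<noteq> 0" "degree p \<le> degree q"
  shows "((\<lambda>x. poly p x / poly q x) \<longlongrightarrow> coeff p (degree q) / lead_coeff q) at_infinity"
proof (cases "degree p = degree q")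
  case True
  have "((\<lambda>x. (poly p x / x ^ degree p) / (poly q x / x ^ degree q))
           \<longlongrightarrow> lead_coeff p / lead_coeff q) at_infinity"
    using assms(1) by (intro tendsto_divide poly_divide_tendsto_aux) simp
  moreover have "eventually (\<lambda>x::'a. (poly p x / x ^ degree p) / (poly q x / x ^ degree q)
                                   = poly p x / poly q x) at_infinity"
    by (rule eventually_at_infinityI[of 1]) (auto simp: True)
  ultimately show ?thesis unfolding True by (rule Lim_transform_eventually)
next
  case False
  with assms have "degree p < degree q" by simp
  thus ?thesis by (simp add: coeff_eq_0 poly_divide_tendsto_0_at_infinity)
qed

lemma eventually_poly_nonzero_at_infinity:
  fixes p :: "'a :: real_normed_field poly"
  assumes "p \<noteq> 0"
  shows "eventually (\<lambda>x. poly p x \<noteq> 0) at_infinity"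
proof -
  have "eventually (\<lambda>x. poly p x / x ^ degree p \<noteq> 0) at_infinity"
    by (rule tendsto_imp_eventually_ne[OF poly_divide_tendsto_aux]) (use assms in simp)
  thus ?thesis by eventually_elim auto
qed

lemma poly_quotient_at_infinity:
  fixes p q :: "'a :: real_normed_field poly"
  assumes "q \<noteq> 0" "degree p > degree q"
  shows "filterlim (\<lambda>x. poly p x / poly q x) at_infinity at_infinity"
proof -
  have "p \<noteq> 0" using assms by auto
  have "((\<lambda>x. poly q x / poly p x) \<longlongrightarrow> 0) at_infinity"
    by (rule poly_divide_tendsto_0_at_infinity) fact
  moreover have "eventually (\<lambda>x. poly q x / poly p x \<noteq> 0) at_infinity"
    using eventually_poly_nonzero_at_infinity[OF assms(1)] eventually_poly_nonzero_at_infinity[OF \<open>p \<noteq> 0\<close>]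
    by eventually_elim simp
  ultimately have "filterlim (\<lambda>x. poly q x / poly p x) (at 0) at_infinity"
    by (simp add: filterlim_at)
  from filterlim_compose[OF filterlim_inverse_at_infinity this] show ?thesis by simp
qed

text \<open>Applying p / q commutes with passing to the sphere: the limit of \<open>Q\<close> at
  \<open>a\<close>, finite or infinite, is inserted into p / q.\<close>

lemma to_sphere_poly_quotient:
  assumes "not_essential Q a" and nonconst: "\<And>c. eventually (\<lambda>z. Q z \<noteq> c) (at a)"
    and "q \<noteq> 0" "coprime p q"
  shows "to_sphere (\<lambda>z. poly p (Q z) / poly q (Q z)) a = rational_eval p q (to_sphere Q a)"
proof (cases "is_pole Q a")
  case True
  hence Q: "filterlim Q at_infinity (at a)" by (simp add: is_pole_def)
  show ?thesis
  proof (cases "degree p > degree q")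
    case deg: True
    have "is_pole (\<lambda>z. poly p (Q z) / poly q (Q z)) a"
      unfolding is_pole_def
      by (rule filterlim_compose[OF poly_quotient_at_infinity[OF \<open>q \<noteq> 0\<close> deg] Q])
    thus ?thesis using True deg by (simp add: to_sphere_def)
  next
    case deg: False
    hence "degree p \<le> degree q" by simp
    from filterlim_compose[OF poly_quotient_tendsto_at_infinity[OF \<open>q \<noteq> 0\<close> this] Q]
    have "to_sphere (\<lambda>z. poly p (Q z) / poly q (Q z)) a
            = Finite (coeff p (degree q) / lead_coeff q)"
      by (rule to_sphere_eq_FiniteI)
    thus ?thesis using True deg by (simp add: to_sphere_def)
  qed
next
  case False
  then obtain c where c: "Q \<midarrow>a\<rightarrow> c" using assms(1) by (auto simp: not_essential_def)
  have Qa: "to_sphere Q a = Finite c" by (rule to_sphere_eq_FiniteI) fact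
  have p: "(\<lambda>z. poly p (Q z)) \<midarrow>a\<rightarrow> poly p c" and q: "(\<lambda>z. poly q (Q z)) \<midarrow>a\<rightarrow> poly q c"
    using c by (auto intro!: tendsto_intros)
  show ?thesis
  proof (cases "poly q c = 0")
    case True
    \<comment> \<open>Coprimality excludes a limit of the form 0/0.\<close>
    have "poly p c \<noteq> 0"
      using True assms(4) by (meson coprime_poly_0)
    have "finite {x. poly q x = 0}" using \<open>q \<noteq> 0\<close> by (rule poly_roots_finite)
    \<comment> \<open>\<open>Q\<close> avoids the finitely many roots of \<open>q\<close> near
      \<open>a\<close>, so the denominator tends to 0 without taking the value 0, where the quotient
      would be the default 0 and not large.\<close>
    hence "eventually (\<lambda>z. \<forall>x\<in>{x. poly q x = 0}. Q z \<noteq> x) (at a)"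
      using nonconst by (intro eventually_ball_finite) auto
    hence "eventually (\<lambda>z. poly q (Q z) \<noteq> 0) (at a)" by eventually_elim auto
    with q True have "filterlim (\<lambda>z. poly q (Q z)) (at 0) (at a)" by (simp add: filterlim_at)
    with p \<open>poly p c \<noteq> 0\<close> have "is_pole (\<lambda>z. poly p (Q z) / poly q (Q z)) a"
      unfolding is_pole_def by (intro filterlim_divide_at_infinity)
    thus ?thesis using True by (simp add: Qa) (simp add: to_sphere_def)
  next
    case nz: False
    have "(\<lambda>z. poly p (Q z) / poly q (Q z)) \<midarrow>a\<rightarrow> poly p c / poly q c"
      by (intro tendsto_divide p q nz)
    from to_sphere_eq_FiniteI[OF this] show ?thesis using nz by (simp add: Qa)
  qed
qed

subsection \<open>Invariant functions\<close>

context hexagonal_lattice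
begin

text \<open>Invariance is demanded off \<open>L\<close> only, because values at lattice points may
  be arbitrary defaults.\<close>

definition hex_invariant :: "(complex \<Rightarrow> complex) \<Rightarrow> bool" where
  "hex_invariant f \<longleftrightarrow>
     (\<forall>z. z \<notin> L \<longrightarrow> (\<forall>l\<in>L. f (z + l) = f z) \<and> f (- z) = f z \<and> f (\<omega> * z) = f z)"

lemma hex_invariantI:
  assumes "\<And>z l. z \<notin> L \<Longrightarrow> l \<in> L \<Longrightarrow> f (z + l) = f z"
    and "\<And>z. z \<notin> L \<Longrightarrow> f (- z) = f z" "\<And>z. z \<notin> L \<Longrightarrow> f (\<omega> * z) = f z"
  shows "hex_invariant f"
  using assms unfolding hex_invariant_def by blast

lemma hex_invariantD:
  assumes "hex_invariant f" "z \<notin> L"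
  shows "l \<in> L \<Longrightarrow> f (z + l) = f z" "f (- z) = f z" "f (\<omega> * z) = f z"
  using assms unfolding hex_invariant_def by blast+

text \<open>Sphere values depend on small punctured neighbourhoods, and these avoid
  \<open>L\<close>; hence the invariance extends to every point.\<close>

lemma to_sphere_invariant:
  assumes "hex_invariant f"
  shows "l \<in> L \<Longrightarrow> to_sphere f (z + l) = to_sphere f z"
    and "to_sphere f (- z) = to_sphere f z"
    and "to_sphere f (\<omega> * z) = to_sphere f z"
proof -
  have *: "to_sphere f (c * z + d) = to_sphere f z"
    if "c \<noteq> 0" "\<And>w. w \<notin> L \<Longrightarrow> f (c * w + d) = f w" for c d
    by (rule to_sphere_affine[OF that(1)])
       (use eventually_not_in_lattice[of z] in eventually_elim, rule that(2))
  show "to_sphere f (z + l) = to_sphere f z" if "l \<in> L"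
    using *[of 1 l] hex_invariantD(1)[OF assms _ that] by simp
  show "to_sphere f (- z) = to_sphere f z"
    using *[of "-1" 0] hex_invariantD(2)[OF assms] by simp
  show "to_sphere f (\<omega> * z) = to_sphere f z"
    using *[of \<omega> 0] hex_invariantD(3)[OF assms] omega_nz by simp
qed

text \<open>Subtracting the integer parts of the real coordinates leaves two coefficients in [0, 1),
  and both basis vectors have norm |\<omega>1|.\<close>

lemma fundamental_domain:
  obtains l where "l \<in> L" "z - l \<in> cball 0 (2 * norm \<omega>1)"
proof -
  define u where "u = z / \<omega>1"
  \<comment> \<open>Coordinates of \<open>u\<close> with respect to 1 and \<open>\<omega>\<close>,
    found by comparing imaginary parts first and real parts next.\<close>
  define b where "b = Im u / Im \<omega>"
  define a where "a = Re u - b * Re \<omega>"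
  have "Im \<omega> \<noteq> 0" using Im_omega_squared by auto
  hence "u = of_real a + of_real b * \<omega>"
    by (simp add: complex_eq_iff a_def b_def)
  hence z: "z = of_real a * \<omega>1 + of_real b * (\<omega> * \<omega>1)"
    using omega1_nz unfolding u_def by (simp add: divide_eq_eq algebra_simps)
  define l where "l = of_int \<lfloor>a\<rfloor> * \<omega>1 + of_int \<lfloor>b\<rfloor> * (\<omega> * \<omega>1)"
  have "norm \<omega> = 1"
    using arg_cong[OF omega_cubed, of norm] power_eq_1_iff[of "norm \<omega>" 3] by (simp add: norm_power)
  have "z - l = of_real (frac a) * \<omega>1 + of_real (frac b) * (\<omega> * \<omega>1)"
    by (simp add: z l_def frac_def algebra_simps)
  hence "norm (z - l) \<le> norm (of_real (frac a) * \<omega>1) + norm (of_real (frac b) * (\<omega> * \<omega>1))"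
    by (metis norm_triangle_ineq)
  also have "\<dots> = frac a * norm \<omega>1 + frac b * norm \<omega>1"
    using \<open>norm \<omega> = 1\<close> by (simp add: norm_mult frac_ge_0)
  also have "\<dots> \<le> 1 * norm \<omega>1 + 1 * norm \<omega>1"
    by (intro add_mono mult_right_mono) (auto simp: frac_lt_1 less_imp_le)
  finally have "z - l \<in> cball 0 (2 * norm \<omega>1)" by simp
  moreover have "l \<in> L" unfolding l_def lattice_of_def by blast
  ultimately show ?thesis by (rule that[rotated])
qed

lemma eventually_shift_lattice:
  assumes "\<And>z. z \<notin> L \<Longrightarrow> P z \<Longrightarrow> P (z + l)" "eventually P (at a)"
  shows "eventually P (at (a + l))"
proof -
  have "eventually (\<lambda>z. P (z + l)) (at a)"
    using assms(2) eventually_not_in_lattice[of a] by eventually_elim (use assms(1) in auto)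
  moreover have "filtermap (\<lambda>z. 1 * z + l) (at a) = at (1 * a + l)"
    by (rule filtermap_affine_at) simp
  ultimately show ?thesis by (simp add: filter_eq_iff eventually_filtermap)
qed

lemma pole_order_le_shift:
  assumes "hex_invariant f" "l \<in> L" "pole_order_le f a n"
  shows "pole_order_le f (a + l) n"
proof -
  obtain h where h: "h analytic_on {a}" "eventually (\<lambda>z. f z * (z - a) ^ n = h z) (at a)"
    using assms unfolding pole_order_le_def by blast
  show ?thesis
  proof (rule pole_order_leI)
    have "(h \<circ> (\<lambda>z. z - l)) analytic_on {a + l}"
      using h(1) by (intro analytic_on_compose) (auto intro!: analytic_intros)
    thus "(\<lambda>z. h (z - l)) analytic_on {a + l}" by (simp add: o_def)
    have "eventually (\<lambda>z. f z * (z - a) ^ n = h z \<and> z \<notin> L) (at a)"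
      using h(2) eventually_not_in_lattice[of a] by eventually_elim simp
    hence "eventually (\<lambda>z. f (z + l) * (z - a) ^ n = h z) (at a)"
      by eventually_elim (use hex_invariantD(1)[OF assms(1) _ assms(2)] in auto)
    moreover have "filtermap (\<lambda>z. 1 * z + l) (at a) = at (1 * a + l)"
      by (rule filtermap_affine_at) simp
    hence "at (a + l) = filtermap (\<lambda>z. z + l) (at a)" by simp
    ultimately show "eventually (\<lambda>z. f z * (z - (a + l)) ^ n = h (z - l)) (at (a + l))"
      by (simp add: eventually_filtermap algebra_simps)
  qed
qed

text \<open>With its singularities removed, \<open>f\<close> is entire and periodic. All its values
  are attained on a compact ball, so Liouville's theorem applies.\<close>

lemma invariant_without_poles_constant:
  assumes "hex_invariant f" "\<And>a. pole_order_le f a 0"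
  shows "\<exists>c. \<forall>a. eventually (\<lambda>z. f z = c) (at a)"
proof -
  define g where "g = remove_sings f"
  have ana: "g analytic_on UNIV"
    unfolding g_def analytic_on_analytic_at[of _ UNIV]
    using assms(2) pole_order_le_0_imp_remove_sings_analytic by blast
  hence holo: "g holomorphic_on UNIV" by (rule analytic_imp_holomorphic)
  have per: "g (z + l) = g z" if "l \<in> L" for z l
    unfolding g_def using to_sphere_invariant(1)[OF assms(1) that]
    by (rule to_sphere_eq_imp_remove_sings_eq)
  have "range g \<subseteq> g ` cball 0 (2 * norm \<omega>1)"
  proof clarify
    fix z
    obtain l where "l \<in> L" "z - l \<in> cball 0 (2 * norm \<omega>1)" by (rule fundamental_domain)
    thus "g z \<in> g ` cball 0 (2 * norm \<omega>1)" using per[of l "z - l"] by force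
  qed
  moreover have "compact (g ` cball 0 (2 * norm \<omega>1))"
    by (intro compact_continuous_image holomorphic_on_imp_continuous_on
          holomorphic_on_subset[OF holo]) auto
  ultimately have "bounded (range g)"
    using bounded_subset compact_imp_bounded by blast
  with holo have "g constant_on UNIV" by (rule Liouville_theorem)
  then obtain c where c: "g z = c" for z by (auto simp: constant_on_def)
  have "eventually (\<lambda>z. f z = c) (at a)" for a
  proof -
    have "isolated_singularity_at f a"
      using assms(2)[of a] by (simp add: pole_order_le_0_iff meromorphic_at_iff)
    hence "eventually (\<lambda>z. g z = f z) (at a)"
      unfolding g_def by (rule eventually_remove_sings_eq_at)
    thus ?thesis by eventually_elim (use c in simp)
  qed
  thus ?thesis by blast
qed

text \<open>-1 has order 2 and \<open>\<omega>\<close> has order 3.\<close>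

lemma dvd_6I:
  assumes "(-1) ^ n = (1 :: complex)" "\<omega> ^ n = 1"
  shows "6 dvd n"
proof -
  have "even n" using assms(1) by (metis power_minus_odd power_one one_neq_neg_one)
  have "\<omega> ^ n = \<omega> ^ (3 * (n div 3) + n mod 3)" by simp
  also have "\<dots> = \<omega> ^ (n mod 3)"
    by (simp only: power_add power_mult omega_cubed) simp
  finally have r: "\<omega> ^ (n mod 3) = 1" using assms(2) by simp
  have "n mod 3 \<noteq> 1" using r omega_neq_1 by auto
  moreover have "n mod 3 \<noteq> 2"
  proof
    assume "n mod 3 = 2"
    hence "\<omega>\<^sup>2 = 1" using r by simp
    hence "\<omega> = 1" using omega_cubed by (simp add: power2_eq_square power3_eq_cube)
    with omega_neq_1 show False by simp
  qed
  ultimately have "3 dvd n" by presburger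
  with \<open>even n\<close> show ?thesis by presburger
qed

end

text \<open>A generator \<open>Q\<close> is an invariant function whose only poles are the lattice points, all of the
  least order that the symmetry allows for a nonconstant function.\<close>
locale hexagonal_generator = hexagonal_lattice +
  fixes Q q :: "complex \<Rightarrow> complex"
  assumes Q_analytic: "Q analytic_on - L"
    and Q_invariant: "hex_invariant Q"
    and q_analytic: "q analytic_on {0}" and q_nz: "q 0 \<noteq> 0"
    and Q_eq_near_0: "eventually (\<lambda>z. Q z * z ^ 6 = q z) (at 0)"
begin

section \<open>Expressing invariant functions through a generator\<close>

lemma Q_pole_order_off_lattice: "a \<notin> L \<Longrightarrow> pole_order_le Q a 0"
  using Q_analytic analytic_on_analytic_at by (blast intro: pole_order_le_analytic)

lemma Q_pole_order: "pole_order_le Q 0 6"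
  using pole_order_leI[OF q_analytic] Q_eq_near_0 by simp

lemma Q_meromorphic: "Q meromorphic_on UNIV"
proof (subst meromorphic_on_meromorphic_at, safe)
  fix a
  show "Q meromorphic_on {a}"
  proof (cases "a \<in> L")
    case True
    from pole_order_le_shift[OF Q_invariant this Q_pole_order] show ?thesis
      using pole_order_le_imp_meromorphic by simp
  qed (use Q_pole_order_off_lattice pole_order_le_imp_meromorphic in blast)
qed

lemma tendsto_q: "q \<midarrow>0\<rightarrow> q 0"
  using analytic_at_imp_isCont[OF q_analytic] by (simp add: isCont_def)

text \<open>Near 0, Q z * z^6 tends to \<open>q 0 \<noteq> 0\<close> whereas c * z^6 tends to 0;
  translation settles all of \<open>L\<close>. Elsewhere, accumulating solutions of Q z = c would
  force Q = c off \<open>L\<close> by the identity theorem, contradicting the behaviour near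
  0.\<close>

lemma Q_nonconstant: "eventually (\<lambda>z. Q z \<noteq> c) (at a)"
proof -
  have "(\<lambda>z. q z - c * z ^ 6) \<midarrow>0\<rightarrow> q 0 - c * 0 ^ 6"
    by (intro tendsto_intros tendsto_q)
  hence "eventually (\<lambda>z. q z - c * z ^ 6 \<noteq> 0) (at 0)"
    by (rule tendsto_imp_eventually_ne) (use q_nz in simp)
  hence at_0: "eventually (\<lambda>z. Q z \<noteq> c) (at 0)"
    using Q_eq_near_0 by eventually_elim auto
  show ?thesis
  proof (cases "a \<in> L")
    case True
    from eventually_shift_lattice[OF _ at_0, of a] show ?thesis
      using hex_invariantD(1)[OF Q_invariant] True by simp
  next
    case False
    show ?thesis
    proof (rule ccontr)
      assume *: "\<not> ?thesis"
      define U where "U = {z \<in> - L. Q z = c}"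
      have "a islimpt U"
      proof (rule ccontr)
        assume "\<not> a islimpt U"
        hence "eventually (\<lambda>z. z \<notin> U) (at a)" by (simp add: islimpt_iff_eventually)
        hence "eventually (\<lambda>z. Q z \<noteq> c) (at a)"
          using eventually_not_in_lattice[of a] by eventually_elim (auto simp: U_def)
        with * show False by simp
      qed
      have "(\<lambda>z. Q z - c) holomorphic_on - L"
        using analytic_imp_holomorphic[OF Q_analytic] by (intro holomorphic_intros)
      hence Q_eq: "Q z - c = 0" if "z \<notin> L" for z
        by (rule analytic_continuation[where U = U and S = "- L" and \<xi> = a])
           (use that False \<open>a islimpt U\<close> connected_Compl_lattice closed_lattice[of L]
            in \<open>auto simp: U_def open_closed\<close>)
      have "eventually (\<lambda>z. Q z = c) (at 0)"
        using eventually_not_in_lattice[of 0] by eventually_elim (use Q_eq in auto)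
      with at_0 have "eventually (\<lambda>z::complex. False) (at 0)" by eventually_elim simp
      thus False by simp
    qed
  qed
qed

text \<open>If \<open>f\<close> is invariant under multiplication by \<zeta>, then h (\<zeta> z) =
  \<zeta>^n h z near 0, and z \<rightarrow> 0 gives h 0 = \<zeta>^n h 0. A nonzero
  \<open>h 0\<close> would thus force \<zeta>^n = 1 for both \<zeta> = -1 and \<zeta> =
  \<omega>.\<close>

lemma leading_coefficient_eq_0:
  assumes "hex_invariant f" "h analytic_on {0}" "eventually (\<lambda>z. f z * z ^ n = h z) (at 0)"
    and "\<not> 6 dvd n"
  shows "h 0 = 0"
proof (rule ccontr)
  assume "h 0 \<noteq> 0"
  have h: "h \<midarrow>0\<rightarrow> h 0"
    using analytic_at_imp_isCont[OF assms(2)] by (simp add: isCont_def)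
  have *: "\<zeta> ^ n = 1" if \<zeta>: "\<zeta> \<noteq> 0" "\<And>z. z \<notin> L \<Longrightarrow> f (\<zeta> * z) = f z" for \<zeta>
  proof -
    have fm: "filterlim (\<lambda>z. \<zeta> * z) (at 0) (at 0)"
      using filtermap_affine_at[OF \<zeta>(1), of 0 0] by (simp add: filterlim_def)
    have "eventually (\<lambda>z. f (\<zeta> * z) * (\<zeta> * z) ^ n = h (\<zeta> * z)) (at 0)"
      by (rule eventually_compose_filterlim[OF assms(3) fm])
    hence "eventually (\<lambda>z. h (\<zeta> * z) = \<zeta> ^ n * h z) (at 0)"
      using assms(3) eventually_not_in_lattice[of 0]
      by eventually_elim (metis \<zeta>(2) mult.left_commute power_mult_distrib)
    moreover have "((\<lambda>z. h (\<zeta> * z)) \<longlongrightarrow> h 0) (at 0)"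
      by (rule filterlim_compose[OF h fm])
    ultimately have "((\<lambda>z. \<zeta> ^ n * h z) \<longlongrightarrow> h 0) (at 0)"
      by (rule Lim_transform_eventually[rotated])
    moreover have "((\<lambda>z. \<zeta> ^ n * h z) \<longlongrightarrow> \<zeta> ^ n * h 0) (at 0)"
      by (intro tendsto_intros h)
    ultimately have "h 0 = \<zeta> ^ n * h 0" using at_neq_bot tendsto_unique by blast
    thus ?thesis using \<open>h 0 \<noteq> 0\<close> by simp
  qed
  have "(-1) ^ n = (1 :: complex)"
    by (rule *) (use hex_invariantD(2)[OF assms(1)] in auto)
  moreover have "\<omega> ^ n = 1"
    by (rule *) (use hex_invariantD(3)[OF assms(1)] omega_nz in auto)
  ultimately show False using dvd_6I assms(4) by blast
qed

text \<open>The induction runs on a bound for the pole order at 0, so each step lowers it by exactly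
  1, also when nothing has to be subtracted. Equality is claimed near each point only, since
  isolated values of \<open>f\<close> are arbitrary.\<close>

lemma polynomial_in_Q:
  assumes "hex_invariant f" "\<And>a. a \<notin> L \<Longrightarrow> pole_order_le f a 0" "pole_order_le f 0 n"
  shows "\<exists>p. \<forall>a. eventually (\<lambda>z. f z = poly p (Q z)) (at a)"
  using assms
proof (induction n arbitrary: f)
  case 0
  have "pole_order_le f a 0" for a
    using "0.prems"(2)[of a] pole_order_le_shift[OF "0.prems"(1) _ "0.prems"(3), of a] by auto
  from invariant_without_poles_constant[OF "0.prems"(1) this] obtain c
    where "\<forall>a. eventually (\<lambda>z. f z = c) (at a)" by blast
  hence "\<forall>a. eventually (\<lambda>z. f z = poly [:c:] (Q z)) (at a)" by simp
  thus ?case by blast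
next
  case (Suc n f)
  obtain h where h: "h analytic_on {0}" "eventually (\<lambda>z. f z * z ^ Suc n = h z) (at 0)"
    using Suc.prems(3) unfolding pole_order_le_def by auto
  \<comment> \<open>\<open>c * Q^k\<close> is to cancel the leading coefficient. If 6 does not
    divide \<open>Suc n\<close>, that coefficient already vanishes and \<open>c = 0\<close> will
    do.\<close>
  obtain c k where ck: "h 0 - c * q 0 ^ k = 0" "c \<noteq> 0 \<Longrightarrow> 6 * k = Suc n"
  proof (cases "6 dvd Suc n")
    case True
    thus ?thesis using that[of "h 0 / q 0 ^ (Suc n div 6)" "Suc n div 6"] q_nz by simp
  next
    case False
    thus ?thesis using that[of 0 0] leading_coefficient_eq_0[OF Suc.prems(1) h] by simp
  qed
  define g where "g = (\<lambda>z. f z - c * Q z ^ k)"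
  have "hex_invariant g"
    using Suc.prems(1) Q_invariant unfolding g_def hex_invariant_def by simp
  moreover have "pole_order_le g a 0" if "a \<notin> L" for a
  proof -
    have "pole_order_le (\<lambda>z. poly (monom (- c) k) (Q z)) a 0"
      using pole_order_le_poly[OF Q_pole_order_off_lattice[OF that]] by simp
    from pole_order_le_add[OF Suc.prems(2)[OF that] this] show ?thesis
      by (simp add: g_def poly_monom)
  qed
  moreover have "pole_order_le g 0 n"
  proof (rule pole_order_le_reduce)
    show "(\<lambda>z. h z - c * q z ^ k) analytic_on {0}" using h(1) q_analytic by (intro analytic_intros)
    show "h 0 - c * q 0 ^ k = 0" by (rule ck)
    show "eventually (\<lambda>z. g z * (z - 0) ^ Suc n = h z - c * q z ^ k) (at 0)"
      using h(2) Q_eq_near_0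
    proof eventually_elim
      case (elim z)
      have "c * Q z ^ k * z ^ Suc n = c * q z ^ k"
      proof (cases "c = 0")
        case False
        show ?thesis
          unfolding ck(2)[OF False, symmetric] elim(2)[symmetric]
          by (simp add: power_mult power_mult_distrib)
      qed simp
      with elim(1) show ?case by (simp add: g_def left_diff_distrib)
    qed
  qed
  ultimately obtain p where p: "\<And>a. eventually (\<lambda>z. g z = poly p (Q z)) (at a)"
    using Suc.IH by blast
  have "eventually (\<lambda>z. f z = poly (p + monom c k) (Q z)) (at a)" for a
    using p[of a] by eventually_elim (simp add: g_def poly_monom algebra_simps)
  thus ?case by blast
qed

text \<open>The compact ball \<open>K\<close> meets every class modulo \<open>L\<close>, and only
  finitely many poles lie in it. It suffices to clear those outside \<open>L\<close>: translation
  carries the result to all points off \<open>L\<close>.\<close>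

lemma rational_in_Q:
  assumes "hex_invariant f" "f meromorphic_on UNIV"
  shows "\<exists>p r. r \<noteq> 0 \<and> (\<forall>a. eventually (\<lambda>z. f z = poly p (Q z) / poly r (Q z)) (at a))"
proof -
  define K where "K = cball (0 :: complex) (2 * norm \<omega>1)"
  define S where "S = {a \<in> K - L. is_pole f a}"
  have f_at: "f meromorphic_on {a}" for a
    using assms(2) by (rule meromorphic_on_subset) simp
  have "{z. \<not> \<not> is_pole f z} sparse_in UNIV"
    using meromorphic_on_imp_not_pole_cosparse[OF assms(2)] by (simp only: eventually_cosparse)
  hence "{z. is_pole f z} sparse_in K" using sparse_in_subset[of _ UNIV K] by simp
  hence "finite (K \<inter> {z. is_pole f z})"
    by (intro sparse_in_compact_finite) (auto simp: K_def)
  hence "finite S" by (rule finite_subset[rotated]) (auto simp: S_def)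
  have "\<forall>a. \<exists>n. pole_order_le f a n" using f_at pole_order_le_meromorphic by blast
  then obtain m where m: "pole_order_le f a (m a)" for a by metis
  \<comment> \<open>The exponent \<open>m a\<close> is any bound for the order of the pole at
    \<open>a\<close>; the factor for \<open>a\<close> becomes (Q z - Q a)^(m a).\<close>
  define r where "r = (\<Prod>a\<in>S. [:- Q a, 1:] ^ m a)"
  have "r \<noteq> 0" using \<open>finite S\<close> by (simp add: r_def)
  define g where "g = (\<lambda>z. poly r (Q z) * f z)"
  have g_inv: "hex_invariant g"
    using assms(1) Q_invariant unfolding g_def hex_invariant_def by simp
  have poly_Q: "pole_order_le (\<lambda>z. poly p (Q z)) a 0" if "a \<notin> L" for p a
    using pole_order_le_poly[OF Q_pole_order_off_lattice[OF that]] by simp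
  have g_K: "pole_order_le g a 0" if a: "a \<in> K - L" for a
  proof (cases "a \<in> S")
    case True
    define r' where "r' = (\<Prod>b\<in>S - {a}. [:- Q b, 1:] ^ m b)"
    have r: "r = [:- Q a, 1:] ^ m a * r'"
      unfolding r_def r'_def using \<open>finite S\<close> True by (rule prod.remove)
    have "pole_order_le (\<lambda>z. (Q z - Q a) ^ m a * f z) a 0"
      using a Q_analytic analytic_on_analytic_at by (blast intro: pole_order_le_clear m)
    from pole_order_le_mult[OF poly_Q[of a r'] this] a show ?thesis
      by (simp add: g_def r mult_ac)
  next
    case False
    hence "pole_order_le f a 0" using a f_at by (simp add: pole_order_le_0_iff S_def)
    from pole_order_le_mult[OF poly_Q[of a r] this] a show ?thesis by (simp add: g_def)
  qed
  have "pole_order_le g a 0" if "a \<notin> L" for a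
  proof -
    obtain l where l: "l \<in> L" "a - l \<in> K" unfolding K_def by (rule fundamental_domain)
    have "a - l \<notin> L" using add_lattice_iff[OF l(1), of "a - l"] that by simp
    hence "pole_order_le g (a - l) 0" using g_K l(2) by simp
    from pole_order_le_shift[OF g_inv l(1) this] show ?thesis by simp
  qed
  moreover obtain n where "pole_order_le g 0 n"
    unfolding g_def using pole_order_le_poly[OF Q_pole_order, of r] pole_order_le_mult m by blast
  ultimately obtain p where p: "\<And>a. eventually (\<lambda>z. g z = poly p (Q z)) (at a)"
    using polynomial_in_Q[OF g_inv] by blast
  have "eventually (\<lambda>z. f z = poly p (Q z) / poly r (Q z)) (at a)" for a
  proof -
    \<comment> \<open>\<open>Q\<close> avoids the roots of \<open>r\<close> near \<open>a\<close>,
      which permits division by \<open>poly r (Q z)\<close>.\<close>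
    have "eventually (\<lambda>z. \<forall>x\<in>{x. poly r x = 0}. Q z \<noteq> x) (at a)"
      using Q_nonconstant poly_roots_finite[OF \<open>r \<noteq> 0\<close>] by (intro eventually_ball_finite) auto
    with p[of a] show ?thesis
    proof eventually_elim
      case (elim z)
      have "poly r (Q z) \<noteq> 0" using elim(2) by blast
      thus ?case using elim(1) by (simp add: g_def field_simps)
    qed
  qed
  with \<open>r \<noteq> 0\<close> show ?thesis by blast
qed

lemma to_sphere_rational:
  assumes "r \<noteq> 0" "coprime p r"
  shows "to_sphere (\<lambda>z. poly p (Q z) / poly r (Q z)) z = rational_eval p r (to_sphere Q z)"
  using Q_meromorphic assms
  by (intro to_sphere_poly_quotient Q_nonconstant) (auto simp: meromorphic_on_altdef)

lemma sphere_invariant_iff_rational: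
  "meromorphic_map F \<and> (\<forall>z. (\<forall>l\<in>L. F (z + l) = F z) \<and> F (- z) = F z \<and> F (\<omega> * z) = F z)
     \<longleftrightarrow> (\<exists>U. rational_map U \<and> F = (\<lambda>z. U (to_sphere Q z)))"
proof
  assume "\<exists>U. rational_map U \<and> F = (\<lambda>z. U (to_sphere Q z))"
  then obtain U where U: "rational_map U" and F: "F = (\<lambda>z. U (to_sphere Q z))" by blast
  obtain p r where pr: "r \<noteq> 0" "coprime p r" "U = rational_eval p r"
    using U by (auto simp: rational_map_def)
  have "F = to_sphere (\<lambda>z. poly p (Q z) / poly r (Q z))"
    by (rule ext) (simp add: F pr to_sphere_rational)
  moreover have "(\<lambda>z. poly s (Q z)) meromorphic_on UNIV" for s
    by (induction s) (auto intro!: meromorphic_intros Q_meromorphic)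
  hence "(\<lambda>z. poly p (Q z) / poly r (Q z)) meromorphic_on UNIV"
    by (intro meromorphic_intros)
  ultimately have "meromorphic_map F" by (auto simp: meromorphic_map_def)
  thus "meromorphic_map F \<and> (\<forall>z. (\<forall>l\<in>L. F (z + l) = F z) \<and> F (- z) = F z \<and> F (\<omega> * z) = F z)"
    by (simp add: F to_sphere_invariant[OF Q_invariant])
next
  assume *: "meromorphic_map F \<and> (\<forall>z. (\<forall>l\<in>L. F (z + l) = F z) \<and> F (- z) = F z \<and> F (\<omega> * z) = F z)"
  then obtain g where g: "g meromorphic_on UNIV" "F = to_sphere g"
    by (auto simp: meromorphic_map_def)
  \<comment> \<open>The invariance of \<open>F\<close> says nothing about stray values of
    \<open>g\<close>; after normalisation it becomes a pointwise identity for
    \<open>f\<close>.\<close>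
  define f where "f = remove_sings g"
  have "f meromorphic_on UNIV" unfolding f_def by (rule remove_sings_meromorphic) fact
  moreover have F: "F = to_sphere f" by (simp add: f_def g to_sphere_remove_sings)
  have "hex_invariant f"
    by (rule hex_invariantI; unfold f_def; rule to_sphere_eq_imp_remove_sings_eq)
       (use * in \<open>simp_all add: g(2)\<close>)
  ultimately obtain p r where r: "r \<noteq> 0"
    and pr: "\<And>a. eventually (\<lambda>z. f z = poly p (Q z) / poly r (Q z)) (at a)"
    using rational_in_Q by blast
  \<comment> \<open>\<open>rational_map\<close> asks for a reduced fraction. Cancelling
    \<open>d\<close> is valid near every point because \<open>Q\<close> avoids the roots of
    \<open>d\<close> there.\<close>
  define d where "d = gcd p r"
  have "d \<noteq> 0" using r by (simp add: d_def)
  obtain p' r' where p': "p = p' * d" and r': "r = r' * d" and cop: "coprime p' r'"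
    using gcd_coprime_exists[of p r] \<open>d \<noteq> 0\<close> unfolding d_def by blast
  have "r' \<noteq> 0" using r r' by auto
  have "F z = rational_eval p' r' (to_sphere Q z)" for z
  proof -
    have "eventually (\<lambda>w. \<forall>x\<in>{x. poly d x = 0}. Q w \<noteq> x) (at z)"
      using Q_nonconstant poly_roots_finite[OF \<open>d \<noteq> 0\<close>] by (intro eventually_ball_finite) auto
    with pr[of z] have "eventually (\<lambda>w. f w = poly p' (Q w) / poly r' (Q w)) (at z)"
      by eventually_elim (auto simp: p' r')
    hence "F z = to_sphere (\<lambda>w. poly p' (Q w) / poly r' (Q w)) z"
      unfolding F by (rule to_sphere_cong)
    thus ?thesis using to_sphere_rational[OF \<open>r' \<noteq> 0\<close> cop] by simp
  qed
  hence "F = (\<lambda>z. rational_eval p' r' (to_sphere Q z))" by blast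
  moreover have "rational_map (rational_eval p' r')"
    using \<open>r' \<noteq> 0\<close> cop by (auto simp: rational_map_def)
  ultimately show "\<exists>U. rational_map U \<and> F = (\<lambda>z. U (to_sphere Q z))" by blast
qed

end

section \<open>From generators to the group p6\<close>

text \<open>Induction over the generated group; for an inverse, apply the invariance under
  \<open>h\<close> at the preimage of \<open>z\<close>. Membership in \<open>Bij UNIV\<close> is
  carried along because the product of \<open>BijGroup\<close> is composition only there.\<close>

lemma invariant_under_generate_iff:
  assumes "H \<subseteq> carrier (BijGroup UNIV)"
  shows "invariant_under (generate (BijGroup UNIV) H) f \<longleftrightarrow> (\<forall>g\<in>H. \<forall>z. f (g z) = f z)"
proof
  assume *: "\<forall>g\<in>H. \<forall>z. f (g z) = f z"
  have "g \<in> Bij UNIV \<and> (\<forall>z. f (g z) = f z)" if "g \<in> generate (BijGroup UNIV) H" for g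
    using that
  proof (induction rule: generate.induct)
    case one
    show ?case using id_Bij[of UNIV] by (simp add: BijGroup_def restrict_def)
  next
    case (incl h)
    thus ?case using * assms by (auto simp: BijGroup_def)
  next
    case (inv h)
    have h: "h \<in> Bij UNIV" using inv assms by (auto simp: BijGroup_def)
    have "f (inv_into UNIV h z) = f z" for z
    proof -
      have "h (inv_into UNIV h z) = z" using h by (simp add: Bij_def bij_is_surj surj_f_inv_f)
      thus ?thesis using * inv by metis
    qed
    thus ?case using h restrict_inv_into_Bij[OF h] by (simp add: inv_BijGroup restrict_def)
  next
    case (eng h1 h2)
    thus ?case by (auto simp: BijGroup_def compose_Bij) (simp add: compose_def)
  qed
  thus "invariant_under (generate (BijGroup UNIV) H) f" by (auto simp: invariant_under_def)
qed (auto simp: invariant_under_def intro: generate.incl)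

context hexagonal_lattice
begin

lemma invariant_under_p6_iff:
  "invariant_under (p6_group \<omega> L) f
     \<longleftrightarrow> (\<forall>z. (\<forall>l\<in>L. f (z + l) = f z) \<and> f (- z) = f z \<and> f (\<omega> * z) = f z)"
proof -
  have "(\<lambda>z. z + l) \<in> Bij UNIV" for l :: complex
    by (auto simp: Bij_def intro!: bij_betw_byWitness[where f' = "\<lambda>z. z - l"])
  moreover have "(\<lambda>z. - z) \<in> Bij (UNIV :: complex set)"
    by (auto simp: Bij_def intro!: bij_betw_byWitness[where f' = "\<lambda>z. - z"])
  moreover have "(\<lambda>z. \<omega> * z) \<in> Bij UNIV"
    using omega_nz by (auto simp: Bij_def intro!: bij_betw_byWitness[where f' = "\<lambda>z. z / \<omega>"])
  ultimately have "{(\<lambda>z. z + l) | l. l \<in> L} \<union> {\<lambda>z. - z, \<lambda>z. \<omega> * z} \<subseteq> carrier (BijGroup UNIV)"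
    by (auto simp: BijGroup_def)
  from invariant_under_generate_iff[OF this] show ?thesis
    unfolding p6_group_def by auto
qed

lemma p6_invariant_eq_rational:
  assumes "hexagonal_generator \<omega> \<omega>1 Q q"
  shows "{f. meromorphic_map f \<and> invariant_under (p6_group \<omega> L) f}
           = {(\<lambda>z. U (to_sphere Q z)) | U. rational_map U}"
  using hexagonal_generator.sphere_invariant_iff_rational[OF assms]
  by (auto simp: invariant_under_p6_iff)

lemma eventually_punctured_nhd_0: "eventually (\<lambda>z. z \<noteq> 0 \<and> z \<notin> L) (at (0::complex))"
  using eventually_not_in_lattice[of 0] by eventually_elim (use lattice_0 in auto)

section \<open>The two generators\<close>

text \<open>Cubing turns the factor \<open>\<omega>\<close> of \<open>wp_omega\<close> into 1. Near
  0, wp z * z^2 equals 1 + z^2 * wp_reg z, so the leading coefficient is 1.\<close>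

lemma wp_cubed_generator: "hexagonal_generator \<omega> \<omega>1 (\<lambda>w. wp w ^ 3) (\<lambda>z. (1 + z\<^sup>2 * wp_reg z) ^ 3)"
proof unfold_locales
  show "(\<lambda>w. wp w ^ 3) analytic_on - L" by (intro analytic_intros wp_analytic)
  show "hex_invariant (\<lambda>w. wp w ^ 3)"
    by (rule hex_invariantI)
       (simp_all add: wp_periodic wp_minus wp_omega power_mult_distrib omega_cubed)
  show "(\<lambda>z. (1 + z\<^sup>2 * wp_reg z) ^ 3) analytic_on {0}"
    by (intro analytic_intros wp_reg_analytic) simp
  show "eventually (\<lambda>z. wp z ^ 3 * z ^ 6 = (1 + z\<^sup>2 * wp_reg z) ^ 3) (at 0)"
    using eventually_punctured_nhd_0
  proof eventually_elim
    case (elim z)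
    have "wp z ^ 3 * z ^ 6 = (wp z * z\<^sup>2) ^ 3" by (simp add: power_mult_distrib)
    also have "wp z * z\<^sup>2 = 1 + z\<^sup>2 * wp_reg z" using elim by (simp add: wp_eq algebra_simps)
    finally show ?case .
  qed
qed simp

text \<open>The derivative is odd and already invariant under \<open>\<omega>\<close>, so squaring
  suffices. Near 0, its product with z^3 tends to -2, so the leading coefficient is 4.\<close>

lemma deriv_wp_squared_generator:
  "hexagonal_generator \<omega> \<omega>1 (\<lambda>w. deriv wp w ^ 2) (\<lambda>z. (- 2 + z ^ 3 * deriv wp_reg z)\<^sup>2)"
proof unfold_locales
  show "(\<lambda>w. deriv wp w ^ 2) analytic_on - L"
    by (intro analytic_intros analytic_deriv wp_analytic)
  show "hex_invariant (\<lambda>w. deriv wp w ^ 2)"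
    by (rule hex_invariantI) (simp_all add: deriv_wp_periodic deriv_wp_minus deriv_wp_omega)
  show "(\<lambda>z. (- 2 + z ^ 3 * deriv wp_reg z)\<^sup>2) analytic_on {0}"
    by (intro analytic_intros analytic_deriv wp_reg_analytic) simp
  show "eventually (\<lambda>z. deriv wp z ^ 2 * z ^ 6 = (- 2 + z ^ 3 * deriv wp_reg z)\<^sup>2) (at 0)"
    using eventually_punctured_nhd_0
  proof eventually_elim
    case (elim z)
    have "deriv wp z ^ 2 * z ^ 6 = (deriv wp z * z ^ 3)\<^sup>2" by (simp add: power_mult_distrib)
    also have "deriv wp z * z ^ 3 = - 2 + z ^ 3 * deriv wp_reg z"
      using elim by (simp add: deriv_wp_eq algebra_simps)
    finally show ?case .
  qed
qed simp

end

theorem proposition10: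
  fixes \<omega> \<omega>1 :: complex
  assumes "\<omega> ^ 3 = 1" and "\<omega> \<noteq> 1" and "\<omega>1 \<noteq> 0"
  shows "let \<Lambda> = lattice_of \<omega>1 (\<omega> * \<omega>1);
             P = weierstrass_p \<Lambda>;
             G = p6_group \<omega> \<Lambda>
         in {f. meromorphic_map f \<and> invariant_under G f} =
              {(\<lambda>z. U (to_sphere (\<lambda>w. P w ^ 3) z)) | U. rational_map U} \<and>
            {f. meromorphic_map f \<and> invariant_under G f} =
              {(\<lambda>z. V (to_sphere (\<lambda>w. deriv P w ^ 2) z)) | V. rational_map V}"
proof -
  interpret hexagonal_lattice \<omega> \<omega>1 by unfold_locales fact+
  show ?thesis
    unfolding Let_def
    using p6_invariant_eq_rational[OF wp_cubed_generator]
      p6_invariant_eq_rational[OF deriv_wp_squared_generator] by (rule conjI)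
qed

end
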